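(* Let $r,s$ be positive integers and let $\lambda=(\lambda_1,\ldots,\lambda_r)$, $\mu=(\mu_1,\ldots,\mu_r)$ be partitions (zero parts allowed) with $\mu\subset\lambda\subset(s^r)$, with conjugates $\lambda'=(\lambda'_1,\ldots,\lambda'_s)$ and $\mu'=(\mu'_1,\ldots,\mu'_s)$ (zero parts allowed). Let $\boldsymbol{s}=(s_{ij})\in W^{\mathrm{diag}}_{\lambda/\mu}$, and let $(a_k)_{k\in\mathbb{Z}}$ be complex numbers with $\Re(a_k)\ge1$ for all $k$ and $s_{ij}=a_{j-i}$ for all $(i,j)\in D(\lambda/\mu)$. (1) Assume further that $\Re(s_{i,\lambda_i})=\Re(a_{\lambda_i-i})>1$ for all $1\le i\le r$. Then $$\zeta_{\lambda/\mu}(\boldsymbol{s})=\det\left[\zeta^{\star}(a_{\mu_j-j+1},a_{\mu_j-j+2},\ldots,a_{\mu_j-j+(\lambda_i-\mu_j-i+j)})\right]_{1\le i,j\le r},$$ where the $(i,j)$ entry is understood to be $1$ if $\lambda_i-\mu_j-i+j=0$ and $0$ if $\lambda_i-\mu_j-i+j<0$. (2) Assume further that $\Re(s_{\lambda'_i,i})=\Re(a_{i-\lambda'_i})>1$ for all $1\le i\le s$. Then $$\zeta_{\lambda/\mu}(\boldsymbol{s})=\det\left[\zeta(a_{-\mu'_j+j-1},a_{-\mu'_j+j-2},\ldots,a_{-\mu'_j+j-(\lambda'_i-\mu'_j-i+j)})\right]_{1\le i,j\le s},$$ where the $(i,j)$ entry is understood to be $1$ if $\lambda'_i-\mu'_j-i+j=0$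 and $0$ if $\lambda'_i-\mu'_j-i+j<0$.
   Context: $\zeta(s_1,\ldots,s_n)=\sum_{0<m_1<\cdots<m_n}\prod_i m_i^{-s_i}$ and $\zeta^{\star}(s_1,\ldots,s_n)=\sum_{0<m_1\le\cdots\le m_n}\prod_i m_i^{-s_i}$ (sums over positive integers), absolutely convergent if $\Re(s_i)\ge1$ for $i<n$ and $\Re(s_n)>1$. $D(\lambda)=\{(i,j):1\le j\le\lambda_i\}$; $\mu\subset\lambda$ means $\mu_i\le\lambda_i$ for all $i$; $(s^r)$ is the partition with $r$ parts equal to $s$; $D(\lambda/\mu)=D(\lambda)\setminus D(\mu)$. The conjugate is $\lambda'_i=\#\{j:\lambda_j\ge i\}$. $C(\lambda/\mu)$ is the set of corners: $(i,j)\in D(\lambda/\mu)$ with $(i+1,j),(i,j+1)\notin D(\lambda/\mu)$. $T(\lambda/\mu,X)$ is the set of fillings of $D(\lambda/\mu)$ by elements of $X$; $T^{\mathrm{diag}}(\lambda/\mu,X)$ is the subset with $t_{ij}=t_{kl}$ whenever $j-i=l-k$. $\mathrm{SSYT}(\lambda/\mu)$ is the set of semi-standard fillings by positive integers (rows weakly increasing, columns strictly increasing). The skew Schur multiple zeta function is $$\zeta_{\lambda/\mu}(\boldsymbol{s})=\sum_{(m_{ij})\in\mathrm{SSYT}(\lambda/\mu)}\prod_{(i,j)\in D(\lambda/\mu)}m_{ij}^{-s_{ij}}.$$ $W_{\lambda/\mu}$ is the set of $\boldsymbol{s}\in T(\lambda/\mu,\mathbb{C})$ with $\Re(s_{ij})\ge1$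 for non-corners and $\Re(s_{ij})>1$ for corners; $W^{\mathrm{diag}}_{\lambda/\mu}=W_{\lambda/\mu}\cap T^{\mathrm{diag}}(\lambda/\mu,\mathbb{C})$. *)

theory Defs
  imports
    "HOL-Library.FuncSet"
    "HOL-Analysis.Infinite_Sum"
    "HOL-Analysis.Complex_Transcendental"
    "Jordan_Normal_Form.Determinant"
begin

text \<open>
  A partition \<open>(\<nu>\<^sub>1, \<nu>\<^sub>2, \<dots>)\<close> is a function on the positive integers, eventually
  zero.  The value at index 0 carries no meaning and is never used.
\<close>

definition is_partition :: "(nat \<Rightarrow> nat) \<Rightarrow> bool" where
  "is_partition \<nu> \<longleftrightarrow> (\<forall>i\<ge>1. \<nu> (Suc i) \<le> \<nu> i) \<and> finite {i. 1 \<le> i \<and> \<nu> i \<noteq> 0}"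

definition part_subset :: "(nat \<Rightarrow> nat) \<Rightarrow> (nat \<Rightarrow> nat) \<Rightarrow> bool" where
  "part_subset \<mu> \<nu> \<longleftrightarrow> (\<forall>i\<ge>1. \<mu> i \<le> \<nu> i)"

definition rect_part :: "nat \<Rightarrow> nat \<Rightarrow> nat \<Rightarrow> nat" where
  "rect_part s r i = (if 1 \<le> i \<and> i \<le> r then s else 0)"

definition conj_part :: "(nat \<Rightarrow> nat) \<Rightarrow> nat \<Rightarrow> nat" where
  "conj_part \<nu> i = card {j. 1 \<le> j \<and> i \<le> \<nu> j}"

definition diagram :: "(nat \<Rightarrow> nat) \<Rightarrow> (nat \<times> nat) set" where
  "diagram \<nu> = {(i, j). 1 \<le> i \<and> 1 \<le> j \<and> j \<le> \<nu> i}"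

definition skew_diagram :: "(nat \<Rightarrow> nat) \<Rightarrow> (nat \<Rightarrow> nat) \<Rightarrow> (nat \<times> nat) set" where
  "skew_diagram \<nu> \<mu> = diagram \<nu> - diagram \<mu>"

definition corners :: "(nat \<Rightarrow> nat) \<Rightarrow> (nat \<Rightarrow> nat) \<Rightarrow> (nat \<times> nat) set" where
  "corners \<nu> \<mu> = {(i, j) \<in> skew_diagram \<nu> \<mu>.
     (i + 1, j) \<notin> skew_diagram \<nu> \<mu> \<and> (i, j + 1) \<notin> skew_diagram \<nu> \<mu>}"

text \<open>
  Fillings are extensional functions (\<open>undefined\<close> off the diagram), so that each filling
  is represented exactly once and sums over sets of fillings are the intended ones.
\<close>

definition fillings :: "(nat \<Rightarrow> nat) \<Rightarrow> (nat \<Rightarrow> nat) \<Rightarrow> 'a set \<Rightarrow> (nat \<times> nat \<Rightarrow> 'a) set" where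
  "fillings \<nu> \<mu> X = skew_diagram \<nu> \<mu> \<rightarrow>\<^sub>E X"

definition diag_fillings :: "(nat \<Rightarrow> nat) \<Rightarrow> (nat \<Rightarrow> nat) \<Rightarrow> 'a set \<Rightarrow> (nat \<times> nat \<Rightarrow> 'a) set" where
  "diag_fillings \<nu> \<mu> X = {t \<in> fillings \<nu> \<mu> X.
     \<forall>(i, j) \<in> skew_diagram \<nu> \<mu>. \<forall>(k, l) \<in> skew_diagram \<nu> \<mu>.
       int j - int i = int l - int k \<longrightarrow> t (i, j) = t (k, l)}"

definition SSYT :: "(nat \<Rightarrow> nat) \<Rightarrow> (nat \<Rightarrow> nat) \<Rightarrow> (nat \<times> nat \<Rightarrow> nat) set" where
  "SSYT \<nu> \<mu> = {m \<in> fillings \<nu> \<mu> {0<..}.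
     (\<forall>i j j'. (i, j) \<in> skew_diagram \<nu> \<mu> \<and> (i, j') \<in> skew_diagram \<nu> \<mu> \<and> j < j'
        \<longrightarrow> m (i, j) \<le> m (i, j')) \<and>
     (\<forall>i i' j. (i, j) \<in> skew_diagram \<nu> \<mu> \<and> (i', j) \<in> skew_diagram \<nu> \<mu> \<and> i < i'
        \<longrightarrow> m (i, j) < m (i', j))}"

definition schur_zeta ::
  "(nat \<Rightarrow> nat) \<Rightarrow> (nat \<Rightarrow> nat) \<Rightarrow> (nat \<times> nat \<Rightarrow> complex) \<Rightarrow> complex" where
  "schur_zeta \<nu> \<mu> t =
     (\<Sum>\<^sub>\<infinity>m\<in>SSYT \<nu> \<mu>. \<Prod>p\<in>skew_diagram \<nu> \<mu>. of_nat (m p) powr (- t p))"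

definition W :: "(nat \<Rightarrow> nat) \<Rightarrow> (nat \<Rightarrow> nat) \<Rightarrow> (nat \<times> nat \<Rightarrow> complex) set" where
  "W \<nu> \<mu> = {t \<in> fillings \<nu> \<mu> UNIV.
     (\<forall>p \<in> skew_diagram \<nu> \<mu> - corners \<nu> \<mu>. Re (t p) \<ge> 1) \<and>
     (\<forall>p \<in> corners \<nu> \<mu>. Re (t p) > 1)}"

definition W_diag :: "(nat \<Rightarrow> nat) \<Rightarrow> (nat \<Rightarrow> nat) \<Rightarrow> (nat \<times> nat \<Rightarrow> complex) set" where
  "W_diag \<nu> \<mu> = W \<nu> \<mu> \<inter> diag_fillings \<nu> \<mu> UNIV"

definition multi_zeta :: "complex list \<Rightarrow> complex" where
  "multi_zeta z =
     (\<Sum>\<^sub>\<infinity>m\<in>{m :: nat list. length m = length z \<and> (\<forall>x\<in>set m. 0 < x) \<and> sorted_wrt (<) m}.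
        \<Prod>i<length z. of_nat (m ! i) powr (- (z ! i)))"

definition multi_zeta_star :: "complex list \<Rightarrow> complex" where
  "multi_zeta_star z =
     (\<Sum>\<^sub>\<infinity>m\<in>{m :: nat list. length m = length z \<and> (\<forall>x\<in>set m. 0 < x) \<and> sorted_wrt (\<le>) m}.
        \<Prod>i<length z. of_nat (m ! i) powr (- (z ! i)))"

text \<open>
  The determinant of \<open>[f i j]\<close> with \<open>1 \<le> i, j \<le> n\<close>; library matrices are indexed from 0.
\<close>

definition det_from_1 :: "nat \<Rightarrow> (nat \<Rightarrow> nat \<Rightarrow> complex) \<Rightarrow> complex" where
  "det_from_1 n f = det (mat n n (\<lambda>(i, j). f (i + 1) (j + 1)))"

end

theory Submission
  imports Defs
begin

text \<open>
  The power \<open>m\<^sub>i\<^sub>j\<close> to the \<open>- s\<^sub>i\<^sub>j\<close> depends only on the entry and, the exponents being constant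
  along diagonals, on the content \<open>j - i\<close> of its cell.  For arbitrary weights \<open>x m k\<close> of an entry
  \<open>m\<close> at content \<open>k\<close> the Jacobi--Trudi identities already hold for tableaux with entries at most
  \<open>N\<close>; the zeta identities are their limits for \<open>N \<rightarrow> \<infinity>\<close>.

  The finite identities follow by induction on \<open>N\<close>.  Removing the entries \<open>N + 1\<close> from a tableau
  leaves a tableau on a smaller Young diagram, and the removed cells form a horizontal strip
  (\<open>tableau_sum_Suc\<close>).  On the other side, classifying the chains \<open>m\<^sub>1 \<le> \<dots> \<le> m\<^sub>n\<close> or
  \<open>m\<^sub>1 < \<dots> < m\<^sub>n\<close> by whether the last member is \<open>N + 1\<close> gives a recursion for the entries of
  the matrix (\<open>interval_sum_Suc\<close>), and multilinearity in the rows expands the determinant for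
  \<open>N + 1\<close> into determinants for \<open>N\<close>.  For the row identity, subtracting from each row a multiple
  of the next one leaves exactly the row lengths with \<open>\<lambda>\<^sub>i\<^sub>+\<^sub>1 \<le> c\<^sub>i \<le> \<lambda>\<^sub>i\<close>, which are the
  complements of horizontal strips (\<open>finite_jacobi_trudi\<close>).  For the column identity each column
  loses at most one cell, and every choice that is not a partition gives two equal rows or a zero
  row (\<open>finite_dual_jacobi_trudi\<close>).  In both cases the induction starts with a matrix of
  Kronecker deltas.

  Replacing every exponent by its real part turns the finite tableau sums into sums of absolute
  values.  They still equal determinants, and these converge because the zeta values in the entries
  do; so they are bounded.  Hence the Schur zeta series converges absolutely, and its sum is the
  limit of the finite sums (\<open>schur_zeta_eq_det\<close>).
\<close>

section \<open>Tableaux with bounded entries\<close>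

definition young :: "(nat \<times> nat) set \<Rightarrow> bool" where
  "young Y \<longleftrightarrow> finite Y \<and>
     (\<forall>i j. (i, j) \<in> Y \<longrightarrow> 1 \<le> i \<and> 1 \<le> j \<and> {1..i} \<times> {1..j} \<subseteq> Y)"

lemma youngD:
  assumes "young Y" "(i, j) \<in> Y"
  shows "1 \<le> i" "1 \<le> j" "\<And>i' j'. 1 \<le> i' \<Longrightarrow> i' \<le> i \<Longrightarrow> 1 \<le> j' \<Longrightarrow> j' \<le> j \<Longrightarrow> (i', j') \<in> Y"
proof -
  have *: "1 \<le> i \<and> 1 \<le> j \<and> {1..i} \<times> {1..j} \<subseteq> Y" using assms unfolding young_def by blast
  thus "1 \<le> i" "1 \<le> j" by auto
  show "(i', j') \<in> Y" if "1 \<le> i'" "i' \<le> i" "1 \<le> j'" "j' \<le> j" for i' j'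
    using * that by (auto dest!: subsetD[of _ _ "(i', j')"])
qed

definition content :: "nat \<times> nat \<Rightarrow> int" where
  "content p = int (snd p) - int (fst p)"

definition tableaux :: "nat \<Rightarrow> (nat \<times> nat) set \<Rightarrow> (nat \<times> nat \<Rightarrow> nat) set" where
  "tableaux N D = {m \<in> D \<rightarrow>\<^sub>E {1..N}.
     (\<forall>i j j'. (i, j) \<in> D \<and> (i, j') \<in> D \<and> j < j' \<longrightarrow> m (i, j) \<le> m (i, j')) \<and>
     (\<forall>i i' j. (i, j) \<in> D \<and> (i', j) \<in> D \<and> i < i' \<longrightarrow> m (i, j) < m (i', j))}"

text \<open>
  The sum is zero by convention unless \<open>M \<subseteq> L\<close>.  The determinants vanish in that case as well, so
  that the recursion for these sums can run over all horizontal strips of \<open>L\<close>.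
\<close>

definition tableau_sum ::
  "(nat \<Rightarrow> int \<Rightarrow> complex) \<Rightarrow> nat \<Rightarrow> (nat \<times> nat) set \<Rightarrow> (nat \<times> nat) set \<Rightarrow> complex" where
  "tableau_sum x N L M =
     (if M \<subseteq> L then \<Sum>m\<in>tableaux N (L - M). \<Prod>p\<in>L - M. x (m p) (content p) else 0)"

text \<open>
  The members are the Young diagrams \<open>Y\<close> for which \<open>L / Y\<close> is a horizontal strip, that is, has at
  most one cell in each column.
\<close>

definition strips :: "(nat \<times> nat) set \<Rightarrow> (nat \<times> nat) set set" where
  "strips L = {Y. young Y \<and> Y \<subseteq> L \<and>
     (\<forall>i i' j. (i, j) \<in> L - Y \<and> (i', j) \<in> L - Y \<longrightarrow> i = i')}"

lemma finite_tableaux: "finite D \<Longrightarrow> finite (tableaux N D)"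
  unfolding tableaux_def by (rule finite_subset[of _ "D \<rightarrow>\<^sub>E {1..N}"]) (auto intro: finite_PiE)

lemma finite_strips: "young L \<Longrightarrow> finite (strips L)"
  by (rule finite_subset[of _ "Pow L"]) (auto simp: strips_def young_def)

lemma tableauxD:
  assumes "m \<in> tableaux N D"
  shows "\<And>p. p \<in> D \<Longrightarrow> 1 \<le> m p" "\<And>p. p \<in> D \<Longrightarrow> m p \<le> N"
    "\<And>p. p \<notin> D \<Longrightarrow> m p = undefined"
    "\<And>i j j'. (i, j) \<in> D \<Longrightarrow> (i, j') \<in> D \<Longrightarrow> j \<le> j' \<Longrightarrow> m (i, j) \<le> m (i, j')"
    "\<And>i i' j. (i, j) \<in> D \<Longrightarrow> (i', j) \<in> D \<Longrightarrow> i < i' \<Longrightarrow> m (i, j) < m (i', j)"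
  proof -
  have m: "m \<in> D \<rightarrow>\<^sub>E {1..N}" using assms by (simp add: tableaux_def)
  show "\<And>p. p \<in> D \<Longrightarrow> 1 \<le> m p" "\<And>p. p \<in> D \<Longrightarrow> m p \<le> N" using PiE_mem[OF m] by auto
  show "\<And>p. p \<notin> D \<Longrightarrow> m p = undefined" using PiE_arb[OF m] by auto
  show "m (i, j) \<le> m (i, j')" if "(i, j) \<in> D" "(i, j') \<in> D" "j \<le> j'" for i j j'
    using assms that unfolding tableaux_def by (cases "j = j'") auto
  show "\<And>i i' j. (i, j) \<in> D \<Longrightarrow> (i', j) \<in> D \<Longrightarrow> i < i' \<Longrightarrow> m (i, j) < m (i', j)"
    using assms unfolding tableaux_def by blast
qed

text \<open>
  Entries increase weakly to the right and downwards, so the cells with entry at most \<open>N\<close> are closed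
  under moving up and left; columns are strict, so each of them contains at most one \<open>N + 1\<close>.
\<close>

lemma strip_of_tableau:
  assumes L: "young L" and M: "young M" "M \<subseteq> L" and m: "m \<in> tableaux (Suc N) (L - M)"
  shows "M \<union> {p \<in> L - M. m p \<le> N} \<in> strips L"
proof -
  let ?Y = "M \<union> {p \<in> L - M. m p \<le> N}"
  have "young ?Y"
    unfolding young_def
  proof (intro conjI allI impI)
    show "finite ?Y" using L M by (auto simp: young_def)
  next
    fix i j assume ij: "(i, j) \<in> ?Y"
    hence ijL: "(i, j) \<in> L" using M by auto
    show "1 \<le> i" "1 \<le> j" using youngD[OF L ijL] by auto
    show "{1..i} \<times> {1..j} \<subseteq> ?Y"
    proof (rule subsetI, rule ccontr)
      fix p assume p: "p \<in> {1..i} \<times> {1..j}" and np: "p \<notin> ?Y"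
      obtain i' j' where p_eq: "p = (i', j')" by (cases p)
      have le: "1 \<le> i'" "i' \<le> i" "1 \<le> j'" "j' \<le> j" using p by (auto simp: p_eq)
      have nM: "(i', j') \<notin> M" using np by (auto simp: p_eq)
      have inL: "(i', j') \<in> L" "(i, j') \<in> L" using youngD(3)[OF L ijL] le by auto
      have notM: "(i, j') \<notin> M" "(i, j) \<notin> M" using youngD(3)[OF M(1)] nM le by blast+
      have "m (i', j') \<le> m (i, j')"
        using tableauxD(5)[OF m, of i' j' i] inL notM nM le by (cases "i' = i") auto
      also have "m (i, j') \<le> m (i, j)"
        using tableauxD(4)[OF m, of i j' j] inL ijL notM le by auto
      also have "m (i, j) \<le> N" using ij notM by auto
      finally show False using inL nM np by (auto simp: p_eq)
    qed
  qed
  moreover have "i = i'" if "(i, j) \<in> L - ?Y" "(i', j) \<in> L - ?Y" for i i' j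
  proof -
    have "m (i, j) = Suc N" "m (i', j) = Suc N"
      using that tableauxD(2)[OF m, of "(i, j)"] tableauxD(2)[OF m, of "(i', j)"] by auto
    thus ?thesis using that tableauxD(5)[OF m, of i j i'] tableauxD(5)[OF m, of i' j i]
      by (cases i i' rule: linorder_cases) auto
  qed
  ultimately show ?thesis using M(2) unfolding strips_def by (intro CollectI conjI) auto
qed

lemma restrict_tableau:
  assumes m: "m \<in> tableaux (Suc N) D"
  shows "restrict m {p \<in> D. m p \<le> N} \<in> tableaux N {p \<in> D. m p \<le> N}"
proof -
  have "restrict m {p \<in> D. m p \<le> N} \<in> {p \<in> D. m p \<le> N} \<rightarrow>\<^sub>E {1..N}"
    using tableauxD(1)[OF m] by simp
  thus ?thesis using tableauxD(4,5)[OF m] by (simp add: tableaux_def)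
qed

text \<open>
  Conversely, filling a horizontal strip with \<open>N + 1\<close> keeps the columns strict, because the strip
  has at most one cell in each column and that cell is the lowest one.
\<close>

lemma extend_tableau:
  assumes Y: "Y \<in> strips L" "M \<subseteq> Y" "young M" and L: "young L" and m: "m \<in> tableaux N (Y - M)"
  shows "(\<lambda>p\<in>L - M. if p \<in> Y then m p else Suc N) \<in> tableaux (Suc N) (L - M)"
    (is "?m \<in> _")
proof -
  have yY: "young Y" "Y \<subseteq> L" using Y by (auto simp: strips_def)
  have strip: "i = i'" if "(i, j) \<in> L" "(i, j) \<notin> Y" "(i', j) \<in> L" "(i', j) \<notin> Y" for i i' j
    using Y(1) that unfolding strips_def by auto
  have le: "m p \<le> N" "1 \<le> m p" if "p \<in> Y" "p \<notin> M" for p using tableauxD[OF m] that by auto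
  have row: "?m (i, j) \<le> ?m (i, j')" if a: "(i, j) \<in> L - M" "(i, j') \<in> L - M" "j < j'" for i j j'
  proof (cases "(i, j') \<in> Y")
    case True
    hence "(i, j) \<in> Y" using youngD(3)[OF yY(1) True] youngD[OF L, of i j] a by auto
    thus ?thesis using True a tableauxD(4)[OF m, of i j j'] by auto
  next
    case False
    thus ?thesis using a le[of "(i, j)"] by auto
  qed
  have col: "?m (i, j) < ?m (i', j)" if a: "(i, j) \<in> L - M" "(i', j) \<in> L - M" "i < i'" for i i' j
  proof (cases "(i', j) \<in> Y")
    case True
    hence "(i, j) \<in> Y" using youngD(3)[OF yY(1) True] youngD[OF L, of i j] a by auto
    thus ?thesis using True a tableauxD(5)[OF m, of i j i'] by auto
  next
    case False
    hence "(i, j) \<in> Y" using strip[of i j i'] a by auto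
    thus ?thesis using a le[of "(i, j)"] False by auto
  qed
  have "?m p \<in> {1..Suc N}" if "p \<in> L - M" for p using le[of p] that by auto
  hence "?m \<in> (L - M) \<rightarrow>\<^sub>E {1..Suc N}" by simp
  thus ?thesis using row col unfolding tableaux_def by blast
qed

text \<open>
  A tableau with entries at most \<open>N + 1\<close> is the same as a horizontal strip, where the entries are
  \<open>N + 1\<close>, together with a tableau with entries at most \<open>N\<close> on the remaining shape.
\<close>

lemma tableau_sum_Suc:
  assumes L: "young L" and M: "young M"
  shows "tableau_sum x (Suc N) L M =
    (\<Sum>Y\<in>strips L. (\<Prod>p\<in>L - Y. x (Suc N) (content p)) * tableau_sum x N Y M)"
proof (cases "M \<subseteq> L")
  case False
  hence "\<not> M \<subseteq> Y" if "Y \<in> strips L" for Y using that by (auto simp: strips_def)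
  thus ?thesis using False by (simp add: tableau_sum_def)
next
  case True
  let ?P = "{Y \<in> strips L. M \<subseteq> Y}"
  have finL: "finite L" using L by (simp add: young_def)
  have "(\<Sum>Y\<in>strips L. (\<Prod>p\<in>L - Y. x (Suc N) (content p)) * tableau_sum x N Y M)
      = (\<Sum>Y\<in>?P. (\<Prod>p\<in>L - Y. x (Suc N) (content p)) * tableau_sum x N Y M)"
    by (rule sum.mono_neutral_right) (auto simp: finite_strips[OF L] tableau_sum_def)
  also have "\<dots> = (\<Sum>Y\<in>?P. \<Sum>m\<in>tableaux N (Y - M).
      (\<Prod>p\<in>L - Y. x (Suc N) (content p)) * (\<Prod>p\<in>Y - M. x (m p) (content p)))"
    by (intro sum.cong) (auto simp: tableau_sum_def sum_distrib_left)
  also have "\<dots> = (\<Sum>(Y, m)\<in>Sigma ?P (\<lambda>Y. tableaux N (Y - M)).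
      (\<Prod>p\<in>L - Y. x (Suc N) (content p)) * (\<Prod>p\<in>Y - M. x (m p) (content p)))"
  proof (rule sum.Sigma)
    show "finite ?P" using finite_strips[OF L] by simp
    show "\<forall>Y\<in>?P. finite (tableaux N (Y - M))"
      by (auto simp: strips_def young_def intro!: finite_tableaux)
  qed
  also have "\<dots> = (\<Sum>m\<in>tableaux (Suc N) (L - M). \<Prod>p\<in>L - M. x (m p) (content p))"
  proof (rule sum.reindex_bij_witness[where
        i = "\<lambda>m. (M \<union> {p \<in> L - M. m p \<le> N}, restrict m {p \<in> L - M. m p \<le> N})" and
        j = "\<lambda>(Y, m). \<lambda>p\<in>L - M. if p \<in> Y then m p else Suc N"], goal_cases)
    case (1 Ym)
    then obtain Y m where Ym: "Ym = (Y, m)" "Y \<in> strips L" "M \<subseteq> Y" "m \<in> tableaux N (Y - M)"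
      by auto
    let ?m = "\<lambda>p\<in>L - M. if p \<in> Y then m p else Suc N"
    have YL: "Y \<subseteq> L" using Ym by (auto simp: strips_def)
    have *: "{p \<in> L - M. ?m p \<le> N} = Y - M"
      using tableauxD(2)[OF Ym(4)] YL by (auto split: if_splits)
    have "restrict ?m (Y - M) = m"
      using tableauxD(3)[OF Ym(4)] YL by (auto simp: fun_eq_iff restrict_def)
    thus ?case using Ym * by auto
  next
    case (2 Ym)
    thus ?case using extend_tableau[OF _ _ M L] by auto
  next
    case (3 m)
    let ?Y = "M \<union> {p \<in> L - M. m p \<le> N}"
    let ?m = "\<lambda>p\<in>L - M. if p \<in> ?Y then restrict m {p \<in> L - M. m p \<le> N} p else Suc N"
    have "?m p = m p" for p
    proof (cases "p \<in> L - M")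
      case True
      thus ?thesis using tableauxD(2)[OF 3 True] by (auto simp: le_Suc_eq)
    next
      case False
      thus ?thesis using tableauxD(3)[OF 3 False] by auto
    qed
    thus ?case by (simp only: prod.case) (rule ext)
  next
    case (4 m)
    have "(M \<union> {p \<in> L - M. m p \<le> N}) - M = {p \<in> L - M. m p \<le> N}" by auto
    thus ?case using strip_of_tableau[OF L M True 4] restrict_tableau[OF 4] by auto
  next
    case (5 Ym)
    then obtain Y m where Ym: "Ym = (Y, m)" "Y \<in> strips L" "M \<subseteq> Y" "m \<in> tableaux N (Y - M)"
      by auto
    have YL: "Y \<subseteq> L" using Ym by (auto simp: strips_def)
    have u: "L - M = (L - Y) \<union> (Y - M)" using YL Ym by auto
    let ?m = "\<lambda>p\<in>L - M. if p \<in> Y then m p else Suc N"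
    have "(\<Prod>p\<in>L - M. x (?m p) (content p)) =
      (\<Prod>p\<in>L - Y. x (?m p) (content p)) * (\<Prod>p\<in>Y - M. x (?m p) (content p))"
      by (subst u, rule prod.union_disjoint) (use finL YL in \<open>auto intro: finite_subset\<close>)
    also have "\<dots> = (\<Prod>p\<in>L - Y. x (Suc N) (content p)) * (\<Prod>p\<in>Y - M. x (m p) (content p))"
      using YL Ym by (intro arg_cong2[of _ _ _ _ "(*)"] prod.cong) auto
    finally show ?case using Ym by simp
  qed
  finally show ?thesis using True by (simp add: tableau_sum_def)
qed

lemma tableau_sum_0:
  assumes "young L"
  shows "tableau_sum x 0 L M = (if L = M then 1 else 0)"
proof -
  have "tableaux 0 D = (if D = {} then {\<lambda>_. undefined} else {})" for D
    unfolding tableaux_def by (auto simp: PiE_eq_empty_iff)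
  thus ?thesis by (auto simp: tableau_sum_def)
qed

section \<open>Truncated multiple zeta values\<close>

definition chains :: "(nat \<Rightarrow> nat \<Rightarrow> bool) \<Rightarrow> nat \<Rightarrow> nat \<Rightarrow> nat list set" where
  "chains R N n = {m. length m = n \<and> set m \<subseteq> {1..N} \<and> sorted_wrt R m}"

definition chain_sum :: "(nat \<Rightarrow> nat \<Rightarrow> bool) \<Rightarrow> (nat \<Rightarrow> 'k \<Rightarrow> complex) \<Rightarrow> nat \<Rightarrow> 'k list \<Rightarrow> complex" where
  "chain_sum R x N ks = (\<Sum>m\<in>chains R N (length ks). \<Prod>i<length ks. x (m ! i) (ks ! i))"

text \<open>
  The entry of the Jacobi--Trudi matrix belonging to a row that occupies the contents
  \<open>q + 1, \<dots>, p\<close>.  An empty row gives 1, and a row of negative length gives 0.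
\<close>

definition interval_sum ::
  "(nat \<Rightarrow> nat \<Rightarrow> bool) \<Rightarrow> (nat \<Rightarrow> int \<Rightarrow> complex) \<Rightarrow> nat \<Rightarrow> int \<Rightarrow> int \<Rightarrow> complex" where
  "interval_sum R x N p q = (if p < q then 0 else chain_sum R x N [q + 1..p])"

lemma finite_chains: "finite (chains R N n)"
proof (rule finite_subset)
  show "chains R N n \<subseteq> {m. set m \<subseteq> {1..N} \<and> length m = n}" by (auto simp: chains_def)
qed (simp add: finite_lists_length_eq)

text \<open>
  The bound \<open>N'\<close> is the largest value allowed before a final \<open>N + 1\<close>.  It is \<open>N + 1\<close> for \<open>\<le>\<close> and
  \<open>N\<close> for \<open><\<close>, so one argument serves both kinds of zeta values.
\<close>

lemma chains_Suc:
  assumes R: "\<And>k l. R k l \<Longrightarrow> k \<le> l"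
    and N': "N' \<le> Suc N" "\<And>k. k \<le> Suc N \<Longrightarrow> R k (Suc N) \<longleftrightarrow> k \<le> N'"
  shows "chains R (Suc N) (Suc n) = chains R N (Suc n) \<union> (\<lambda>m. m @ [Suc N]) ` chains R N' n"
proof (intro equalityI subsetI)
  fix m assume m: "m \<in> chains R (Suc N) (Suc n)"
  then obtain m' k where mk: "m = m' @ [k]" by (cases m rule: rev_cases) (auto simp: chains_def)
  show "m \<in> chains R N (Suc n) \<union> (\<lambda>m. m @ [Suc N]) ` chains R N' n"
  proof (cases "k = Suc N")
    case True
    have "m' \<in> chains R N' n"
      using m N' unfolding mk True chains_def by (force simp: sorted_wrt_append)
    thus ?thesis using mk True by blast
  next
    case False
    have "m \<in> chains R N (Suc n)"
      using m R False unfolding mk chains_def by (fastforce simp: sorted_wrt_append)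
    thus ?thesis by blast
  qed
next
  fix m assume "m \<in> chains R N (Suc n) \<union> (\<lambda>m. m @ [Suc N]) ` chains R N' n"
  thus "m \<in> chains R (Suc N) (Suc n)"
  proof
    assume "m \<in> chains R N (Suc n)" thus ?thesis by (force simp: chains_def)
  next
    assume "m \<in> (\<lambda>m. m @ [Suc N]) ` chains R N' n"
    thus ?thesis using N' by (force simp: chains_def sorted_wrt_append)
  qed
qed

lemma chain_sum_snoc:
  assumes R: "\<And>k l. R k l \<Longrightarrow> k \<le> l"
    and N': "N' \<le> Suc N" "\<And>k. k \<le> Suc N \<Longrightarrow> R k (Suc N) \<longleftrightarrow> k \<le> N'"
  shows "chain_sum R x (Suc N) (ks @ [k]) =
    chain_sum R x N (ks @ [k]) + x (Suc N) k * chain_sum R x N' ks"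
proof -
  let ?f = "\<lambda>m. \<Prod>i<Suc (length ks). x (m ! i) ((ks @ [k]) ! i)"
  have "chains R N (Suc (length ks)) \<inter> (\<lambda>m. m @ [Suc N]) ` chains R N' (length ks) = {}"
    by (auto simp: chains_def)
  hence "chain_sum R x (Suc N) (ks @ [k]) =
    chain_sum R x N (ks @ [k]) + (\<Sum>m\<in>(\<lambda>m. m @ [Suc N]) ` chains R N' (length ks). ?f m)"
    unfolding chain_sum_def
    by (simp add: chains_Suc[of R N' N, OF R N'] sum.union_disjoint finite_chains)
  also have "(\<Sum>m\<in>(\<lambda>m. m @ [Suc N]) ` chains R N' (length ks). ?f m)
    = (\<Sum>m\<in>chains R N' (length ks). x (Suc N) k * (\<Prod>i<length ks. x (m ! i) (ks ! i)))"
    by (subst sum.reindex) (auto simp: inj_on_def chains_def nth_append mult.commute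
        intro!: sum.cong prod.cong)
  finally show ?thesis by (simp add: chain_sum_def sum_distrib_left)
qed

lemma chain_sum_Nil: "chain_sum R x N [] = 1"
proof -
  have "chains R N 0 = {[]}" by (auto simp: chains_def)
  thus ?thesis by (simp add: chain_sum_def)
qed

lemma interval_sum_Suc:
  assumes R: "\<And>k l. R k l \<Longrightarrow> k \<le> l"
    and N': "N' \<le> Suc N" "\<And>k. k \<le> Suc N \<Longrightarrow> R k (Suc N) \<longleftrightarrow> k \<le> N'"
  shows "interval_sum R x (Suc N) p q =
    interval_sum R x N p q + x (Suc N) p * interval_sum R x N' (p - 1) q"
proof (cases p q rule: linorder_cases)
  case greater
  hence "[q + 1..p] = [q + 1..p - 1] @ [p]" by (intro upto_rec2) auto
  thus ?thesis using greater chain_sum_snoc[of R N' N, OF R N'] by (simp add: interval_sum_def)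
qed (auto simp: interval_sum_def chain_sum_Nil)

lemma interval_sum_0: "interval_sum R x 0 p q = (if p = q then 1 else 0)"
proof (cases p q rule: linorder_cases)
  case greater
  have "chains R 0 n = {}" if "n > 0" for n using that by (auto simp: chains_def)
  thus ?thesis using greater by (simp add: interval_sum_def chain_sum_def)
qed (auto simp: interval_sum_def chain_sum_Nil)

lemma interval_sum_less: "p < q \<Longrightarrow> interval_sum R x N p q = 0"
  by (simp add: interval_sum_def)

text \<open>
  Iterating the recursion in the upper end peels off a maximal run of entries \<open>N + 1\<close> that starts
  after position \<open>c\<close>.  The runs starting after a position \<open>c \<ge> n'\<close> give the sum; those reaching
  further down share the factor for the positions \<open>n', \<dots>, n\<close> and add up to a multiple of the value
  at upper end \<open>n' - 1\<close>.  With \<open>n'\<close> the length of the next row of a diagram, that value is the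
  entry of the next row of the matrix.
\<close>

lemma interval_sum_le_interval:
  fixes n n' :: nat and i :: int
  assumes "n' \<le> n"
  shows "interval_sum (\<le>) x (Suc N) (int n - i) q =
    (\<Sum>c\<in>{n'..n}. (\<Prod>k\<in>{c<..n}. x (Suc N) (int k - i)) * interval_sum (\<le>) x N (int c - i) q)
    + (\<Prod>k\<in>{n'..n}. x (Suc N) (int k - i)) * interval_sum (\<le>) x (Suc N) (int n' - 1 - i) q"
  using assms
proof (induction n rule: dec_induct)
  case base
  show ?case by (simp add: interval_sum_Suc[of "(\<le>)" "Suc N" N x "int n' - i"] algebra_simps)
next
  case (step n)
  have *: "{n'..Suc n} = insert (Suc n) {n'..n}" "\<And>c. c \<le> n \<Longrightarrow> {c<..Suc n} = insert (Suc n) {c<..n}"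
    using step by auto
  let ?y = "x (Suc N) (int (Suc n) - i)"
  have "interval_sum (\<le>) x (Suc N) (int (Suc n) - i) q =
      interval_sum (\<le>) x N (int (Suc n) - i) q + ?y * interval_sum (\<le>) x (Suc N) (int n - i) q"
    using interval_sum_Suc[of "(\<le>)" "Suc N" N x "int (Suc n) - i" q] by (simp add: algebra_simps)
  thus ?case unfolding step.IH * using step.hyps
    by (simp add: * algebra_simps sum_distrib_left del: of_nat_Suc)
qed

section \<open>Determinants\<close>

lemma det_from_1_leibniz:
  "det_from_1 n f = (\<Sum>p | p permutes {0..<n}. signof p * (\<Prod>i\<in>{1..n}. f i (p (i - 1) + 1)))"
proof -
  have "(\<Prod>i\<in>{1..n}. f i (p (i - 1) + 1)) =
      (\<Prod>i = 0..<n. mat n n (\<lambda>(i, j). f (i + 1) (j + 1)) $$ (i, p i))"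
    if p: "p permutes {0..<n}" for p
  proof -
    have "(\<Prod>i\<in>{1..n}. f i (p (i - 1) + 1)) = (\<Prod>i\<in>{0..<n}. f (i + 1) (p i + 1))"
      by (rule prod.reindex_bij_witness[of _ Suc "\<lambda>i. i - 1"]) auto
    also have "\<dots> = (\<Prod>i = 0..<n. mat n n (\<lambda>(i, j). f (i + 1) (j + 1)) $$ (i, p i))"
      using permutes_in_image[OF p] by (intro prod.cong) auto
    finally show ?thesis .
  qed
  thus ?thesis unfolding det_from_1_def by (subst det_def'[of _ n]) (auto intro!: sum.cong)
qed

lemma det_from_1_cong:
  assumes "\<And>i j. i \<in> {1..n} \<Longrightarrow> j \<in> {1..n} \<Longrightarrow> f i j = g i j"
  shows "det_from_1 n f = det_from_1 n g"
  unfolding det_from_1_def using assms by (intro arg_cong[of _ _ det] cong_mat) auto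

text \<open>
  Multilinearity in the rows: if row \<open>i\<close> is a combination of vectors indexed by \<open>C i\<close>, the
  determinant is a sum over all simultaneous choices of one vector for each row.
\<close>

lemma det_from_1_rows_sum:
  assumes f: "\<And>i j. i \<in> {1..n} \<Longrightarrow> j \<in> {1..n} \<Longrightarrow> f i j = (\<Sum>c\<in>C i. w i c * g i c j)"
    and fin: "\<And>i. i \<in> {1..n} \<Longrightarrow> finite (C i)"
  shows "det_from_1 n f =
    (\<Sum>c\<in>Pi\<^sub>E {1..n} C. (\<Prod>i\<in>{1..n}. w i (c i)) * det_from_1 n (\<lambda>i j. g i (c i) j))"
proof -
  have "(\<Prod>i\<in>{1..n}. f i (p (i - 1) + 1)) =
      (\<Sum>c\<in>Pi\<^sub>E {1..n} C. \<Prod>i\<in>{1..n}. w i (c i) * g i (c i) (p (i - 1) + 1))"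
    if p: "p permutes {0..<n}" for p
  proof -
    have "p (i - 1) + 1 \<in> {1..n}" if "i \<in> {1..n}" for i
      using permutes_in_image[OF p, of "i - 1"] that by auto
    hence "(\<Prod>i\<in>{1..n}. f i (p (i - 1) + 1)) =
        (\<Prod>i\<in>{1..n}. \<Sum>c\<in>C i. w i c * g i c (p (i - 1) + 1))"
      by (intro prod.cong) (simp_all add: f)
    thus ?thesis by (subst (asm) prod_sum_PiE) (simp_all add: fin)
  qed
  hence "det_from_1 n f = (\<Sum>p | p permutes {0..<n}. \<Sum>c\<in>Pi\<^sub>E {1..n} C.
      signof p * (\<Prod>i\<in>{1..n}. w i (c i) * g i (c i) (p (i - 1) + 1)))"
    unfolding det_from_1_leibniz by (simp add: sum_distrib_left)
  also have "\<dots> = (\<Sum>c\<in>Pi\<^sub>E {1..n} C. \<Sum>p | p permutes {0..<n}.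
      signof p * (\<Prod>i\<in>{1..n}. w i (c i) * g i (c i) (p (i - 1) + 1)))"
    by (rule sum.swap)
  finally show ?thesis
    unfolding det_from_1_leibniz sum_distrib_left by (simp add: prod.distrib mult_ac)
qed

lemma det_from_1_zero_row:
  assumes "i \<in> {1..n}" "\<And>j. j \<in> {1..n} \<Longrightarrow> f i j = 0"
  shows "det_from_1 n f = 0"
proof -
  have "(\<Prod>i\<in>{1..n}. f i (p (i - 1) + 1)) = 0" if p: "p permutes {0..<n}" for p
  proof (rule prod_zero)
    have "p (i - 1) + 1 \<in> {1..n}"
      using permutes_in_image[OF p, of "i - 1"] assms(1) by auto
    thus "\<exists>i\<in>{1..n}. f i (p (i - 1) + 1) = 0" using assms by blast
  qed simp
  hence "signof p * (\<Prod>i\<in>{1..n}. f i (p (i - 1) + 1)) = 0" if "p permutes {0..<n}" for p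
    using that by simp
  thus ?thesis unfolding det_from_1_leibniz by (intro sum.neutral) blast
qed

lemma det_from_1_equal_rows:
  assumes "i \<in> {1..n}" "i' \<in> {1..n}" "i \<noteq> i'" "\<And>j. j \<in> {1..n} \<Longrightarrow> f i j = f i' j"
  shows "det_from_1 n f = 0"
  unfolding det_from_1_def
  by (rule det_identical_rows[of _ n "i - 1" "i' - 1"]) (use assms in \<open>auto simp: Matrix.row_def\<close>)

text \<open>
  The row operation is multiplication by a unitriangular matrix.  A zero row with index \<open>n + 1\<close>
  lets the last row be treated like the others.
\<close>

lemma det_from_1_subtract_next_row:
  assumes "\<And>j. j \<in> {1..n} \<Longrightarrow> f (Suc n) j = 0"
  shows "det_from_1 n (\<lambda>i j. f i j - a i * f (Suc i) j) = det_from_1 n f"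
proof -
  define U where "U = mat n n (\<lambda>(i, j). if i = j then 1 else if j = Suc i then - a (Suc i) else 0)"
  define F where "F = mat n n (\<lambda>(i, j). f (i + 1) (j + 1))"
  have carrier: "U \<in> carrier_mat n n" "F \<in> carrier_mat n n" by (auto simp: U_def F_def)
  have "det U = prod_list (diag_mat U)"
    by (rule det_upper_triangular[of _ n]) (auto simp: U_def upper_triangular_def)
  also have "\<dots> = 1" by (auto simp: U_def prod_list_diag_prod)
  finally have U: "det U = 1" .
  have "mat n n (\<lambda>(i, j). f (i + 1) (j + 1) - a (i + 1) * f (Suc (i + 1)) (j + 1)) = U * F"
  proof (rule eq_matI)
    fix i j assume "i < dim_row (U * F)" "j < dim_col (U * F)"
    hence ij: "i < n" "j < n" by (auto simp: U_def F_def)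
    have "(U * F) $$ (i, j) = (\<Sum>k = 0..<n. U $$ (i, k) * F $$ (k, j))"
      using ij by (simp add: U_def F_def scalar_prod_def)
    also have "\<dots> = (\<Sum>k = 0..<n. (if k = i then f (i + 1) (j + 1) else 0) +
        (if k = Suc i then - a (i + 1) * f (Suc (i + 1)) (j + 1) else 0))"
      using ij by (intro sum.cong) (auto simp: U_def F_def)
    also have "\<dots> = f (i + 1) (j + 1) - a (i + 1) * f (Suc (i + 1)) (j + 1)"
    proof (cases "Suc i < n")
      case False
      hence "Suc i = n" using ij by simp
      thus ?thesis using ij assms[of "j + 1"] by (simp add: sum.distrib)
    qed (use ij in \<open>simp add: sum.distrib\<close>)
    finally show "mat n n (\<lambda>(i, j). f (i + 1) (j + 1) - a (i + 1) * f (Suc (i + 1)) (j + 1)) $$ (i, j)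
        = (U * F) $$ (i, j)" using ij by simp
  qed (auto simp: U_def F_def)
  hence "det_from_1 n (\<lambda>i j. f i j - a i * f (Suc i) j) = det U * det F"
    unfolding det_from_1_def using det_mult[OF carrier] by simp
  thus ?thesis using U by (simp add: F_def det_from_1_def)
qed

definition antitone_upto :: "nat \<Rightarrow> (nat \<Rightarrow> nat) \<Rightarrow> bool" where
  "antitone_upto n c \<longleftrightarrow> (\<forall>i\<in>{1..<n}. c (Suc i) \<le> c i)"

lemma antitone_uptoD:
  assumes "antitone_upto n c" "1 \<le> i" "i \<le> j" "j \<le> n"
  shows "c j \<le> c i"
  using assms(3,4)
proof (induction j rule: dec_induct)
  case (step j)
  have "c (Suc j) \<le> c j" using assms(1,2) step by (auto simp: antitone_upto_def)
  thus ?case using step by simp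
qed simp

text \<open>
  Subtracting the index turns weakly decreasing sequences into strictly decreasing ones.  Unless some
  row is zero, matching equal values therefore defines a strictly increasing map of \<open>{1..n}\<close> to itself,
  which can only be the identity.
\<close>

lemma det_from_1_shifted_delta:
  assumes "antitone_upto n \<nu>" "antitone_upto n \<mu>"
  shows "det_from_1 n (\<lambda>i j. if int (\<nu> i) - int i = int (\<mu> j) - int j then 1 else 0) =
    (if \<forall>i\<in>{1..n}. \<nu> i = \<mu> i then 1 else 0)"
proof -
  let ?f = "\<lambda>i j. if int (\<nu> i) - int i = int (\<mu> j) - int j then 1 else 0 :: complex"
  have shifted_less: "int (c j) - int j < int (c i) - int i"
    if "antitone_upto n c" "1 \<le> i" "i < j" "j \<le> n" for c i j
    using antitone_uptoD[of n c i j] that by simp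
  have inj: "i = j" if "antitone_upto n c" "i \<in> {1..n}" "j \<in> {1..n}"
    "int (c j) - int j = int (c i) - int i" for c i j
  proof (cases i j rule: linorder_cases)
    case less
    thus ?thesis using shifted_less[OF that(1), of i j] that(2-4) by simp
  next
    case greater
    thus ?thesis using shifted_less[OF that(1), of j i] that(2-4) by simp
  qed
  show ?thesis
  proof (cases "\<forall>i\<in>{1..n}. \<nu> i = \<mu> i")
    case True
    have "det_from_1 n ?f = det (1\<^sub>m n)"
      unfolding det_from_1_def
    proof (rule arg_cong[of _ _ det], rule eq_matI)
      fix i j assume ij: "i < dim_row (1\<^sub>m n)" "j < dim_col (1\<^sub>m n)"
      have "int (\<nu> (i + 1)) - int (i + 1) = int (\<mu> (j + 1)) - int (j + 1) \<longleftrightarrow> i = j"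
        using inj[OF assms(2), of "i + 1" "j + 1"] ij bspec[OF True, of "i + 1"] by fastforce
      thus "mat n n (\<lambda>(i, j). ?f (i + 1) (j + 1)) $$ (i, j) = 1\<^sub>m n $$ (i, j)"
        using ij by simp
    qed auto
    thus ?thesis using True by simp
  next
    case False
    have "\<exists>i\<in>{1..n}. \<forall>j\<in>{1..n}. int (\<nu> i) - int i \<noteq> int (\<mu> j) - int j"
    proof (rule ccontr)
      assume "\<not> ?thesis"
      then obtain \<sigma> where \<sigma>: "\<And>i. i \<in> {1..n} \<Longrightarrow> \<sigma> i \<in> {1..n}"
        "\<And>i. i \<in> {1..n} \<Longrightarrow> int (\<nu> i) - int i = int (\<mu> (\<sigma> i)) - int (\<sigma> i)"
        by metis
      have mono: "\<sigma> i < \<sigma> j" if "1 \<le> i" "i < j" "j \<le> n" for i j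
      proof (rule ccontr)
        assume "\<not> \<sigma> i < \<sigma> j"
        hence "int (\<mu> (\<sigma> i)) - int (\<sigma> i) \<le> int (\<mu> (\<sigma> j)) - int (\<sigma> j)"
          using shifted_less[OF assms(2), of "\<sigma> j" "\<sigma> i"] \<sigma>(1)[of i] \<sigma>(1)[of j] that
          by (cases "\<sigma> i = \<sigma> j") simp_all
        moreover have "i \<in> {1..n}" "j \<in> {1..n}" using that by auto
        ultimately show False
          using shifted_less[OF assms(1) that] \<sigma>(2)[of i] \<sigma>(2)[of j] by simp
      qed
      have "i \<le> \<sigma> i" if "1 \<le> i" "i \<le> n" for i
        using that
      proof (induction i rule: dec_induct)
        case base thus ?case using \<sigma>(1)[of 1] by auto
      next
        case (step i) thus ?case using mono[of i "Suc i"] by auto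
      qed
      moreover have "\<sigma> i \<le> i" if "i \<le> n" "1 \<le> i" for i
        using that
      proof (induction i rule: inc_induct)
        case base thus ?case using \<sigma>(1)[of n] by auto
      next
        case (step i) thus ?case using mono[of i "Suc i"] by auto
      qed
      ultimately have "\<sigma> i = i" if "i \<in> {1..n}" for i using that by (simp add: le_antisym)
      thus False using \<sigma>(2) False by auto
    qed
    then obtain i where "i \<in> {1..n}" "\<forall>j\<in>{1..n}. int (\<nu> i) - int i \<noteq> int (\<mu> j) - int j" by blast
    thus ?thesis using False by (subst det_from_1_zero_row[of i]) auto
  qed
qed

section \<open>Diagrams given by row or column lengths\<close>

definition rows_diagram :: "nat \<Rightarrow> (nat \<Rightarrow> nat) \<Rightarrow> (nat \<times> nat) set" where
  "rows_diagram n c = Sigma {1..n} (\<lambda>i. {1..c i})"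

definition cols_diagram :: "nat \<Rightarrow> (nat \<Rightarrow> nat) \<Rightarrow> (nat \<times> nat) set" where
  "cols_diagram n c = prod.swap ` rows_diagram n c"

lemma mem_rows_diagram: "(i, j) \<in> rows_diagram n c \<longleftrightarrow> 1 \<le> i \<and> i \<le> n \<and> 1 \<le> j \<and> j \<le> c i"
  by (auto simp: rows_diagram_def)

lemma mem_cols_diagram: "(i, j) \<in> cols_diagram n c \<longleftrightarrow> (j, i) \<in> rows_diagram n c"
  by (force simp: cols_diagram_def)

lemma young_swap:
  assumes "young Y"
  shows "young (prod.swap ` Y)"
proof -
  have mem: "(i, j) \<in> prod.swap ` Y \<longleftrightarrow> (j, i) \<in> Y" for i j by force
  have "{1..i} \<times> {1..j} \<subseteq> prod.swap ` Y" if "(j, i) \<in> Y" for i j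
    using youngD(3)[OF assms that] mem by auto
  thus ?thesis
    using assms youngD(1,2)[OF assms] unfolding young_def[of "prod.swap ` Y"] mem
    by (auto simp: young_def)
qed

lemma young_rows_diagram:
  assumes "antitone_upto n c"
  shows "young (rows_diagram n c)"
proof -
  have "(i', j') \<in> rows_diagram n c"
    if "(i, j) \<in> rows_diagram n c" "1 \<le> i'" "i' \<le> i" "1 \<le> j'" "j' \<le> j" for i j i' j'
    using that antitone_uptoD[OF assms, of i' i] by (auto simp: mem_rows_diagram)
  thus ?thesis by (auto simp: young_def mem_rows_diagram) (auto simp: rows_diagram_def)
qed

lemma young_cols_diagram: "antitone_upto n c \<Longrightarrow> young (cols_diagram n c)"
  unfolding cols_diagram_def by (intro young_swap young_rows_diagram)

lemma young_eq_rows_diagram: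
  assumes Y: "young Y" and n: "Y \<subseteq> {1..n} \<times> UNIV"
  obtains c where "antitone_upto n c" "c \<in> extensional {1..n}" "Y = rows_diagram n c"
proof -
  define c where "c = (\<lambda>i\<in>{1..n}. card {j. (i, j) \<in> Y})"
  have row: "{j. (i, j) \<in> Y} = {1..c i}" if i: "i \<in> {1..n}" for i
  proof (cases "{j. (i, j) \<in> Y} = {}")
    case False
    have "{j. (i, j) \<in> Y} \<subseteq> snd ` Y" by force
    hence fin: "finite {j. (i, j) \<in> Y}" using Y by (auto simp: young_def intro: finite_subset)
    have "{j. (i, j) \<in> Y} = {1..Max {j. (i, j) \<in> Y}}"
    proof (intro equalityI subsetI)
      fix j assume "j \<in> {1..Max {j. (i, j) \<in> Y}}"
      moreover have "(i, Max {j. (i, j) \<in> Y}) \<in> Y" using Max_in[OF fin False] by simp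
      ultimately show "j \<in> {j. (i, j) \<in> Y}" using youngD(3)[OF Y, of i _ i j] i by auto
    qed (use youngD(2)[OF Y] fin in auto)
    note interval = this
    have "card {j. (i, j) \<in> Y} = Max {j. (i, j) \<in> Y}"
      using arg_cong[OF interval, of card] by (simp only: card_atLeastAtMost)
    hence "c i = Max {j. (i, j) \<in> Y}" using i by (simp add: c_def)
    thus ?thesis using interval by (simp only:)
  qed (use i in \<open>simp add: c_def\<close>)
  show thesis
  proof
    show "Y = rows_diagram n c"
    proof (rule Set.set_eqI)
      fix p :: "nat \<times> nat"
      obtain i j where p: "p = (i, j)" by (cases p)
      have "(i, j) \<in> Y \<longleftrightarrow> i \<in> {1..n} \<and> j \<in> {j. (i, j) \<in> Y}" using n by auto
      also have "\<dots> \<longleftrightarrow> i \<in> {1..n} \<and> j \<in> {1..c i}"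
        by (rule conj_cong) (simp_all only: row)
      also have "\<dots> \<longleftrightarrow> (i, j) \<in> rows_diagram n c" by (auto simp: mem_rows_diagram)
      finally show "p \<in> Y \<longleftrightarrow> p \<in> rows_diagram n c" unfolding p .
    qed
    show "antitone_upto n c"
      unfolding antitone_upto_def
    proof
      fix i assume i: "i \<in> {1..<n}"
      have "{j. (Suc i, j) \<in> Y} \<subseteq> {j. (i, j) \<in> Y}"
      proof (rule subsetI, simp only: mem_Collect_eq)
        fix j assume j: "(Suc i, j) \<in> Y"
        show "(i, j) \<in> Y" using youngD(3)[OF Y j, of i j] youngD(2)[OF Y j] i by simp
      qed
      moreover have "{j. (i, j) \<in> Y} = {1..c i}" "{j. (Suc i, j) \<in> Y} = {1..c (Suc i)}"
        by (rule row; use i in simp)+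
      ultimately have "{1..c (Suc i)} \<subseteq> {1..c i}" by (simp only:)
      thus "c (Suc i) \<le> c i" by (cases "c (Suc i)") auto
    qed
  qed (simp add: c_def)
qed

lemma rows_diagram_eqD:
  assumes "rows_diagram n c = rows_diagram n c'" "i \<in> {1..n}"
  shows "c i = c' i"
proof -
  have "(i, j) \<in> rows_diagram n c \<longleftrightarrow> (i, j) \<in> rows_diagram n c'" for j using assms by simp
  from this[of "c i"] this[of "c' i"] show ?thesis
    using assms(2) by (cases "c i = 0"; cases "c' i = 0") (auto simp: mem_rows_diagram)
qed

definition next_part :: "nat \<Rightarrow> (nat \<Rightarrow> nat) \<Rightarrow> nat \<Rightarrow> nat" where
  "next_part n \<nu> i = (if i < n then \<nu> (Suc i) else 0)"

text \<open>
  Two cells \<open>(i, j)\<close> and \<open>(i + 1, j)\<close> of \<open>\<nu> / c\<close> share a column iff \<open>c\<^sub>i < j \<le> \<nu>\<^sub>i\<^sub>+\<^sub>1\<close>, so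
  horizontal strips are described by the interlacing condition \<open>\<nu>\<^sub>i\<^sub>+\<^sub>1 \<le> c\<^sub>i \<le> \<nu>\<^sub>i\<close>.
\<close>

lemma bij_betw_row_strips:
  assumes \<nu>: "antitone_upto n \<nu>"
  shows "bij_betw (rows_diagram n) (\<Pi>\<^sub>E i\<in>{1..n}. {next_part n \<nu> i..\<nu> i}) (strips (rows_diagram n \<nu>))"
proof (rule bij_betw_imageI)
  show "inj_on (rows_diagram n) (\<Pi>\<^sub>E i\<in>{1..n}. {next_part n \<nu> i..\<nu> i})"
    by (rule inj_onI, rule PiE_ext) (auto dest: rows_diagram_eqD)
  show "rows_diagram n ` (\<Pi>\<^sub>E i\<in>{1..n}. {next_part n \<nu> i..\<nu> i}) = strips (rows_diagram n \<nu>)"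
  proof (intro equalityI subsetI)
    fix Y assume "Y \<in> rows_diagram n ` (\<Pi>\<^sub>E i\<in>{1..n}. {next_part n \<nu> i..\<nu> i})"
    then obtain c where c: "Y = rows_diagram n c" "\<And>i. i \<in> {1..n} \<Longrightarrow> next_part n \<nu> i \<le> c i \<and> c i \<le> \<nu> i"
      by (auto simp: PiE_iff)
    have anti: "antitone_upto n c"
      unfolding antitone_upto_def
    proof
      fix i assume "i \<in> {1..<n}"
      thus "c (Suc i) \<le> c i" using c(2)[of i] c(2)[of "Suc i"] by (simp add: next_part_def)
    qed
    have not_less: "\<not> i < i'"
      if "(i, j) \<in> rows_diagram n \<nu> - Y" "(i', j) \<in> rows_diagram n \<nu> - Y" for i i' j
    proof
      assume "i < i'"
      moreover have "c i < j" "j \<le> \<nu> i'" "i' \<le> n" "1 \<le> i" using that c(1) by (auto simp: mem_rows_diagram)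
      ultimately show False
        using antitone_uptoD[OF \<nu>, of "Suc i" i'] c(2)[of i] by (simp add: next_part_def)
    qed
    have "i = i'" if "(i, j) \<in> rows_diagram n \<nu> - Y" "(i', j) \<in> rows_diagram n \<nu> - Y" for i i' j
      using not_less[OF that] not_less[OF that(2,1)] by simp
    moreover have "Y \<subseteq> rows_diagram n \<nu>"
      using c(2) unfolding c(1) rows_diagram_def by (intro Sigma_mono) auto
    ultimately show "Y \<in> strips (rows_diagram n \<nu>)"
      unfolding strips_def c(1) using young_rows_diagram[OF anti] by blast
  next
    fix Y assume Y: "Y \<in> strips (rows_diagram n \<nu>)"
    hence "young Y" "Y \<subseteq> {1..n} \<times> UNIV" by (auto simp: strips_def rows_diagram_def)
    then obtain c where c: "antitone_upto n c" "c \<in> extensional {1..n}" "Y = rows_diagram n c"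
      by (rule young_eq_rows_diagram)
    have "c i \<in> {next_part n \<nu> i..\<nu> i}" if i: "i \<in> {1..n}" for i
    proof -
      have "c i \<le> \<nu> i"
      proof (rule ccontr)
        assume "\<not> c i \<le> \<nu> i"
        hence "(i, c i) \<in> Y - rows_diagram n \<nu>" using i c(3) by (auto simp: mem_rows_diagram)
        thus False using Y by (auto simp: strips_def)
      qed
      moreover have "\<nu> (Suc i) \<le> c i" if "i < n"
      proof (rule ccontr)
        assume "\<not> \<nu> (Suc i) \<le> c i"
        moreover have "c (Suc i) \<le> c i" "\<nu> (Suc i) \<le> \<nu> i"
          using c(1) \<nu> i that by (auto simp: antitone_upto_def)
        ultimately have "(i, Suc (c i)) \<in> rows_diagram n \<nu> - Y"
          "(Suc i, Suc (c i)) \<in> rows_diagram n \<nu> - Y"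
          using i that c(3) by (auto simp: mem_rows_diagram)
        hence "i = Suc i" using Y unfolding strips_def by blast
        thus False by simp
      qed
      ultimately show ?thesis by (simp add: next_part_def)
    qed
    hence "c \<in> (\<Pi>\<^sub>E i\<in>{1..n}. {next_part n \<nu> i..\<nu> i})" using c(2) by (simp add: PiE_iff)
    thus "Y \<in> rows_diagram n ` (\<Pi>\<^sub>E i\<in>{1..n}. {next_part n \<nu> i..\<nu> i})" using c(3) by blast
  qed
qed

text \<open>
  In terms of column lengths, a horizontal strip takes at most one cell from each column.  Here
  \<open>\<nu> i - 1\<close> is truncated at 0, as an empty column cannot lose a cell.
\<close>

lemma bij_betw_col_strips:
  "bij_betw (cols_diagram n)
    {c \<in> (\<Pi>\<^sub>E i\<in>{1..n}. {\<nu> i - 1..\<nu> i}). antitone_upto n c} (strips (cols_diagram n \<nu>))"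
  (is "bij_betw _ ?C _")
proof (rule bij_betw_imageI)
  show "inj_on (cols_diagram n) ?C"
  proof (rule inj_onI)
    fix c c' assume c: "c \<in> ?C" "c' \<in> ?C" and "cols_diagram n c = cols_diagram n c'"
    hence "rows_diagram n c = rows_diagram n c'"
      by (simp add: cols_diagram_def inj_image_eq_iff)
    thus "c = c'" using c by (intro PiE_ext[of c "{1..n}" _ c']) (auto dest: rows_diagram_eqD)
  qed
  show "cols_diagram n ` ?C = strips (cols_diagram n \<nu>)"
  proof (intro equalityI subsetI)
    fix Y assume "Y \<in> cols_diagram n ` ?C"
    then obtain c where c: "Y = cols_diagram n c" "antitone_upto n c"
      "\<And>i. i \<in> {1..n} \<Longrightarrow> \<nu> i - 1 \<le> c i \<and> c i \<le> \<nu> i"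
      by (auto simp: PiE_iff)
    have "i = i'"
      if "(i, j) \<in> cols_diagram n \<nu> - Y" "(i', j) \<in> cols_diagram n \<nu> - Y" for i i' j
      using that c(3)[of j] unfolding c(1) by (auto simp: mem_cols_diagram mem_rows_diagram)
    moreover have "Y \<subseteq> cols_diagram n \<nu>"
      using c(3) unfolding c(1) cols_diagram_def rows_diagram_def
      by (intro image_mono Sigma_mono) auto
    ultimately show "Y \<in> strips (cols_diagram n \<nu>)"
      unfolding strips_def c(1) using young_cols_diagram[OF c(2)] by blast
  next
    fix Y assume Y: "Y \<in> strips (cols_diagram n \<nu>)"
    hence YD: "young Y" "Y \<subseteq> cols_diagram n \<nu>" by (auto simp: strips_def)
    have "prod.swap ` Y \<subseteq> prod.swap ` prod.swap ` rows_diagram n \<nu>"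
      using YD(2) unfolding cols_diagram_def by (rule image_mono)
    hence "prod.swap ` Y \<subseteq> {1..n} \<times> UNIV" by (force simp: rows_diagram_def image_image)
    then obtain c where c: "antitone_upto n c" "c \<in> extensional {1..n}" "prod.swap ` Y = rows_diagram n c"
      using young_eq_rows_diagram[OF young_swap[OF YD(1)]] by blast
    have Yc: "Y = cols_diagram n c" unfolding cols_diagram_def c(3)[symmetric] by (simp add: image_image)
    have "c i \<in> {\<nu> i - 1..\<nu> i}" if i: "i \<in> {1..n}" for i
    proof -
      have "c i \<le> \<nu> i"
      proof (rule ccontr)
        assume "\<not> c i \<le> \<nu> i"
        hence "(c i, i) \<in> Y - cols_diagram n \<nu>"
          using i Yc by (auto simp: mem_rows_diagram mem_cols_diagram)
        thus False using YD by auto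
      qed
      moreover have "\<nu> i - 1 \<le> c i"
      proof (rule ccontr)
        assume "\<not> \<nu> i - 1 \<le> c i"
        hence "(\<nu> i - 1, i) \<in> cols_diagram n \<nu> - Y" "(\<nu> i, i) \<in> cols_diagram n \<nu> - Y"
          using i Yc by (auto simp: mem_rows_diagram mem_cols_diagram)
        hence "\<nu> i - 1 = \<nu> i" using Y unfolding strips_def by blast
        thus False using \<open>\<not> \<nu> i - 1 \<le> c i\<close> by simp
      qed
      ultimately show ?thesis by simp
    qed
    hence "c \<in> ?C" using c(1,2) by (simp add: PiE_iff)
    thus "Y \<in> cols_diagram n ` ?C" using Yc by blast
  qed
qed

lemma prod_rows_diagram_diff:
  fixes f :: "nat \<times> nat \<Rightarrow> complex"
  shows "(\<Prod>p\<in>rows_diagram n \<nu> - rows_diagram n c. f p) = (\<Prod>i\<in>{1..n}. \<Prod>j\<in>{c i<..\<nu> i}. f (i, j))"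
proof -
  have "rows_diagram n \<nu> - rows_diagram n c = Sigma {1..n} (\<lambda>i. {c i<..\<nu> i})"
    by (auto simp: rows_diagram_def)
  thus ?thesis by (simp add: prod.Sigma case_prod_beta)
qed

lemma prod_cols_diagram_diff:
  fixes f :: "nat \<times> nat \<Rightarrow> complex"
  shows "(\<Prod>p\<in>cols_diagram n \<nu> - cols_diagram n c. f p) = (\<Prod>j\<in>{1..n}. \<Prod>i\<in>{c j<..\<nu> j}. f (i, j))"
proof -
  have "cols_diagram n \<nu> - cols_diagram n c = prod.swap ` (rows_diagram n \<nu> - rows_diagram n c)"
    by (auto simp: cols_diagram_def)
  thus ?thesis using prod_rows_diagram_diff[of "\<lambda>p. f (prod.swap p)"]
    by (simp add: prod.reindex)
qed

lemma rows_diagram_eq_iff: "rows_diagram n c = rows_diagram n c' \<longleftrightarrow> (\<forall>i\<in>{1..n}. c i = c' i)"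
  by (auto dest: rows_diagram_eqD) (auto simp: rows_diagram_def)

section \<open>Jacobi--Trudi identities for bounded entries\<close>

text \<open>
  In the induction step the determinant is unchanged when a multiple of the next row is subtracted
  from each row, with the multiple prescribed by \<open>interval_sum_le_interval\<close>.  What is left of row
  \<open>i\<close> is a sum over the lengths \<open>c\<^sub>i\<close> that interlace with \<open>\<nu>\<close>, and expanding the rows yields the
  recursion of the tableau sums.
\<close>

theorem finite_jacobi_trudi:
  assumes \<mu>: "antitone_upto n \<mu>" and "antitone_upto n \<nu>"
  shows "tableau_sum x N (rows_diagram n \<nu>) (rows_diagram n \<mu>) =
    det_from_1 n (\<lambda>i j. interval_sum (\<le>) x N (int (\<nu> i) - int i) (int (\<mu> j) - int j))"
  using assms(2)
proof (induction N arbitrary: \<nu>)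
  case 0
  thus ?case
    by (simp add: tableau_sum_0 young_rows_diagram interval_sum_0 rows_diagram_eq_iff
        det_from_1_shifted_delta \<mu>)
next
  case (Suc N)
  \<comment> \<open>beyond the last row the length is 0, so that row \<open>n + 1\<close> of the matrix vanishes\<close>
  define p where "p i = (if i \<le> n then int (\<nu> i) - int i else - int i)" for i
  define q where "q j = int (\<mu> j) - int j" for j
  define w where "w i c = (\<Prod>k\<in>{c<..\<nu> i}. x (Suc N) (int k - int i))" for i c
  define a where "a i = (\<Prod>k\<in>{next_part n \<nu> i..\<nu> i}. x (Suc N) (int k - int i))" for i
  let ?C = "\<lambda>i. {next_part n \<nu> i..\<nu> i}"
  have next_le: "next_part n \<nu> i \<le> \<nu> i" if "i \<in> {1..n}" for i
    using Suc.prems that by (auto simp: next_part_def antitone_upto_def)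
  have anti: "antitone_upto n c" if c: "c \<in> Pi\<^sub>E {1..n} ?C" for c
    unfolding antitone_upto_def
  proof
    fix i assume "i \<in> {1..<n}"
    thus "c (Suc i) \<le> c i" using PiE_mem[OF c, of i] PiE_mem[OF c, of "Suc i"]
      by (simp add: next_part_def)
  qed
  have "det_from_1 n (\<lambda>i j. interval_sum (\<le>) x (Suc N) (int (\<nu> i) - int i) (int (\<mu> j) - int j))
      = det_from_1 n (\<lambda>i j. interval_sum (\<le>) x (Suc N) (p i) (q j))"
    by (rule det_from_1_cong) (simp add: p_def q_def)
  also have "\<dots> = det_from_1 n (\<lambda>i j. interval_sum (\<le>) x (Suc N) (p i) (q j)
      - a i * interval_sum (\<le>) x (Suc N) (p (Suc i)) (q j))"
    by (rule det_from_1_subtract_next_row[symmetric]) (simp add: interval_sum_less p_def q_def)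
  also have "\<dots> = (\<Sum>c\<in>Pi\<^sub>E {1..n} ?C. (\<Prod>i\<in>{1..n}. w i (c i)) *
      det_from_1 n (\<lambda>i j. interval_sum (\<le>) x N (int (c i) - int i) (q j)))"
  proof (rule det_from_1_rows_sum)
    fix i j assume i: "i \<in> {1..n}"
    have "int (next_part n \<nu> i) - 1 - int i = p (Suc i)" using i by (simp add: next_part_def p_def)
    thus "interval_sum (\<le>) x (Suc N) (p i) (q j) - a i * interval_sum (\<le>) x (Suc N) (p (Suc i)) (q j)
        = (\<Sum>c\<in>?C i. w i c * interval_sum (\<le>) x N (int c - int i) (q j))"
      using interval_sum_le_interval[OF next_le[OF i], of x N "int i" "q j"] i
      by (simp add: p_def w_def a_def)
  qed simp
  also have "\<dots> = (\<Sum>c\<in>Pi\<^sub>E {1..n} ?C.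
      (\<Prod>p\<in>rows_diagram n \<nu> - rows_diagram n c. x (Suc N) (content p)) *
      tableau_sum x N (rows_diagram n c) (rows_diagram n \<mu>))"
    by (intro sum.cong) (simp_all add: Suc.IH[OF anti] prod_rows_diagram_diff w_def content_def q_def)
  also have "\<dots> = (\<Sum>Y\<in>strips (rows_diagram n \<nu>).
      (\<Prod>p\<in>rows_diagram n \<nu> - Y. x (Suc N) (content p)) * tableau_sum x N Y (rows_diagram n \<mu>))"
    by (rule sum.reindex_bij_betw[OF bij_betw_row_strips[OF Suc.prems]])
  finally show ?case
    by (simp add: tableau_sum_Suc young_rows_diagram Suc.prems \<mu>)
qed

text \<open>
  Going down a column decreases the content, so the weights are reflected in order to write
  contents as increasing intervals.  In the induction step the row of column \<open>i\<close> is the sum of two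
  terms, for keeping its length and for removing one cell.  A choice \<open>c\<close> with \<open>c\<^sub>i < c\<^sub>i\<^sub>+\<^sub>1\<close> forces
  \<open>c\<^sub>i + 1 = c\<^sub>i\<^sub>+\<^sub>1\<close>, which makes two rows equal; and a negative length of the last column makes the
  last row zero.  The remaining choices are the horizontal strips.
\<close>

theorem finite_dual_jacobi_trudi:
  assumes \<mu>: "antitone_upto n \<mu>" and "antitone_upto n \<nu>"
  shows "tableau_sum x N (cols_diagram n \<nu>) (cols_diagram n \<mu>) =
    det_from_1 n (\<lambda>i j. interval_sum (<) (\<lambda>m k. x m (- k)) N (int (\<nu> i) - int i) (int (\<mu> j) - int j))"
  using assms(2)
proof (induction N arbitrary: \<nu>)
  case 0
  have "cols_diagram n \<nu> = cols_diagram n \<mu> \<longleftrightarrow> rows_diagram n \<nu> = rows_diagram n \<mu>"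
    by (simp add: cols_diagram_def inj_image_eq_iff)
  thus ?case using 0
    by (simp add: tableau_sum_0 young_cols_diagram interval_sum_0 rows_diagram_eq_iff
        det_from_1_shifted_delta \<mu>)
next
  case (Suc N)
  define y where "y = (\<lambda>m k. x m (- k))"
  define q where "q j = int (\<mu> j) - int j" for j
  define w where "w i c = (if c = int (\<nu> i) then 1 else y (Suc N) (int (\<nu> i) - int i))" for i c
  define d where "d c = det_from_1 n (\<lambda>i j. interval_sum (<) y N (c i - int i) (q j))" for c :: "nat \<Rightarrow> int"
  let ?I = "Pi\<^sub>E {1..n} (\<lambda>i. {int (\<nu> i) - 1..int (\<nu> i)})"
  let ?C = "{c \<in> (\<Pi>\<^sub>E i\<in>{1..n}. {\<nu> i - 1..\<nu> i}). antitone_upto n c}"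
  let ?e = "\<lambda>c. \<lambda>i\<in>{1..n}. int (c i)"
  \<comment> \<open>integer lengths allow the choice \<open>- 1\<close> for an empty column\<close>
  have vanish: "d c = 0" if c: "c \<in> ?I" "c \<notin> ?e ` ?C" for c
  proof (rule ccontr)
    assume "d c \<noteq> 0"
    have descent: "c (Suc i) \<le> c i" if i: "1 \<le> i" "i < n" for i
    proof (rule ccontr)
      assume less: "\<not> c (Suc i) \<le> c i"
      have "\<nu> (Suc i) \<le> \<nu> i" using Suc.prems i by (simp add: antitone_upto_def)
      hence eq: "c (Suc i) - int (Suc i) = c i - int i"
        using less PiE_mem[OF c(1), of i] PiE_mem[OF c(1), of "Suc i"] i by auto
      have "d c = 0" unfolding d_def
        by (rule det_from_1_equal_rows[of i n "Suc i"]) (use i in \<open>simp_all add: eq del: of_nat_Suc\<close>)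
      thus False using \<open>d c \<noteq> 0\<close> by simp
    qed
    have last: "0 \<le> c n" if "n \<ge> 1"
    proof (rule ccontr)
      assume "\<not> 0 \<le> c n"
      hence "d c = 0" unfolding d_def q_def using that
        by (intro det_from_1_zero_row[of n]) (auto intro!: interval_sum_less)
      thus False using \<open>d c \<noteq> 0\<close> by simp
    qed
    have nonneg: "0 \<le> c i" if "i \<le> n" "1 \<le> i" for i
      using that
    proof (induction i rule: inc_induct)
      case (step i)
      have "c (Suc i) \<le> c i" using step.prems step.hyps by (intro descent) auto
      thus ?case using step by simp
    qed (use last in simp)
    let ?b = "\<lambda>i\<in>{1..n}. nat (c i)"
    have "?b i \<in> {\<nu> i - 1..\<nu> i}" if "i \<in> {1..n}" for i
      using PiE_mem[OF c(1) that] that by auto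
    hence "?b \<in> (\<Pi>\<^sub>E i\<in>{1..n}. {\<nu> i - 1..\<nu> i})" by (auto simp: PiE_iff)
    moreover have "antitone_upto n ?b"
      using descent by (auto simp: antitone_upto_def intro: nat_mono)
    moreover have "c = ?e ?b"
    proof
      fix i show "c i = ?e ?b i"
        using nonneg[of i] PiE_arb[OF c(1), of i] by (cases "i \<in> {1..n}") auto
    qed
    ultimately show False using c(2) by blast
  qed
  have "det_from_1 n (\<lambda>i j. interval_sum (<) y (Suc N) (int (\<nu> i) - int i) (q j))
      = (\<Sum>c\<in>?I. (\<Prod>i\<in>{1..n}. w i (c i)) * d c)"
    unfolding d_def
  proof (rule det_from_1_rows_sum)
    fix i j
    have "{int (\<nu> i) - 1..int (\<nu> i)} = {int (\<nu> i) - 1, int (\<nu> i)}" by auto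
    thus "interval_sum (<) y (Suc N) (int (\<nu> i) - int i) (q j) =
        (\<Sum>c\<in>{int (\<nu> i) - 1..int (\<nu> i)}. w i c * interval_sum (<) y N (c - int i) (q j))"
      using interval_sum_Suc[of "(<)" N N y "int (\<nu> i) - int i" "q j"]
      by (simp add: w_def algebra_simps less_Suc_eq_le)
  qed simp
  also have "\<dots> = (\<Sum>c\<in>?e ` ?C. (\<Prod>i\<in>{1..n}. w i (c i)) * d c)"
  proof (rule sum.mono_neutral_right)
    show "finite ?I" by (rule finite_PiE) auto
    show "?e ` ?C \<subseteq> ?I" by (auto simp: PiE_iff)
  qed (use vanish in auto)
  also have "\<dots> = (\<Sum>c\<in>?C. (\<Prod>i\<in>{1..n}. w i (int (c i))) * d (\<lambda>i. int (c i)))"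
  proof (subst sum.reindex)
    show "inj_on ?e ?C"
    proof (rule inj_onI)
      fix c c' assume c: "c \<in> ?C" "c' \<in> ?C" and "?e c = ?e c'"
      hence "?e c i = ?e c' i" for i by simp
      hence "c i = c' i" if "i \<in> {1..n}" for i using that by (metis of_nat_eq_iff restrict_apply')
      thus "c = c'" using c by (intro PiE_ext[of c "{1..n}" _ c']) auto
    qed
    have "d (?e c) = d (\<lambda>i. int (c i))" for c unfolding d_def by (rule det_from_1_cong) simp
    thus "(sum ((\<lambda>c. (\<Prod>i\<in>{1..n}. w i (c i)) * d c) \<circ> ?e) ?C)
        = (\<Sum>c\<in>?C. (\<Prod>i\<in>{1..n}. w i (int (c i))) * d (\<lambda>i. int (c i)))" by simp
  qed
  also have "\<dots> = (\<Sum>c\<in>?C. (\<Prod>p\<in>cols_diagram n \<nu> - cols_diagram n c. x (Suc N) (content p)) *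
      tableau_sum x N (cols_diagram n c) (cols_diagram n \<mu>))"
  proof (rule sum.cong[OF refl])
    fix c assume c: "c \<in> ?C"
    have "w j (int (c j)) = (\<Prod>i\<in>{c j<..\<nu> j}. x (Suc N) (content (i, j)))" if "j \<in> {1..n}" for j
    proof -
      have "c \<in> (\<Pi>\<^sub>E i\<in>{1..n}. {\<nu> i - 1..\<nu> i})" using c by simp
      hence "c j \<in> {\<nu> j - 1..\<nu> j}" using that by (rule PiE_mem)
      hence "c j = \<nu> j \<or> Suc (c j) = \<nu> j" by auto
      thus ?thesis
      proof
        assume "c j = \<nu> j"
        thus ?thesis by (simp add: w_def)
      next
        assume s: "Suc (c j) = \<nu> j"
        have "{c j<..\<nu> j} = {\<nu> j}"
          by (simp only: atLeastSucAtMost_greaterThanAtMost[symmetric] s atLeastAtMost_singleton)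
        moreover have "int (c j) \<noteq> int (\<nu> j)" using s by simp
        ultimately show ?thesis by (simp add: w_def y_def content_def)
      qed
    qed
    hence "(\<Prod>i\<in>{1..n}. w i (int (c i))) =
        (\<Prod>p\<in>cols_diagram n \<nu> - cols_diagram n c. x (Suc N) (content p))"
      by (simp add: prod_cols_diagram_diff)
    moreover have "d (\<lambda>i. int (c i)) = tableau_sum x N (cols_diagram n c) (cols_diagram n \<mu>)"
      using Suc.IH[of c] c by (simp add: d_def y_def q_def)
    ultimately show "(\<Prod>i\<in>{1..n}. w i (int (c i))) * d (\<lambda>i. int (c i)) =
        (\<Prod>p\<in>cols_diagram n \<nu> - cols_diagram n c. x (Suc N) (content p)) *
        tableau_sum x N (cols_diagram n c) (cols_diagram n \<mu>)" by simp
  qed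
  also have "\<dots> = (\<Sum>Y\<in>strips (cols_diagram n \<nu>).
      (\<Prod>p\<in>cols_diagram n \<nu> - Y. x (Suc N) (content p)) * tableau_sum x N Y (cols_diagram n \<mu>))"
    by (rule sum.reindex_bij_betw[OF bij_betw_col_strips])
  finally show ?case
    by (simp add: tableau_sum_Suc young_cols_diagram Suc.prems \<mu> y_def q_def)
qed

section \<open>Passage to the limit\<close>

lemma infsum_eq_limit_of_exhaustion:
  fixes f :: "'a \<Rightarrow> complex"
  assumes fin: "\<And>N. finite (A N)" and mono: "\<And>N. A N \<subseteq> A (Suc N)" and un: "(\<Union>N. A N) = B"
    and bound: "\<And>N. (\<Sum>m\<in>A N. norm (f m)) \<le> K"
  shows "(\<lambda>N. \<Sum>m\<in>A N. f m) \<longlonglongrightarrow> infsum f B"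
proof -
  have cover: "\<exists>N. \<forall>N'\<ge>N. F \<subseteq> A N'" if "finite F" "F \<subseteq> B" for F
    using that
  proof (induction F rule: finite_induct)
    case (insert m F)
    then obtain N N' where "\<forall>N'\<ge>N. F \<subseteq> A N'" "m \<in> A N'" using un by auto
    hence "\<forall>k\<ge>max N N'. insert m F \<subseteq> A k"
      using lift_Suc_mono_le[of A N', OF mono] by auto
    thus ?case by blast
  qed simp
  have "f summable_on B"
  proof (rule abs_summable_summable, rule nonneg_bdd_above_summable_on)
    show "bdd_above (sum (\<lambda>x. norm (f x)) ` {F. F \<subseteq> B \<and> finite F})"
    proof (rule bdd_aboveI2)
      fix F assume "F \<in> {F. F \<subseteq> B \<and> finite F}"
      then obtain N where "F \<subseteq> A N" using cover[of F] by auto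
      hence "(\<Sum>m\<in>F. norm (f m)) \<le> (\<Sum>m\<in>A N. norm (f m))" by (intro sum_mono2 fin) auto
      also note bound
      finally show "(\<Sum>m\<in>F. norm (f m)) \<le> K" .
    qed
  qed simp
  hence "(sum f \<longlongrightarrow> infsum f B) (finite_subsets_at_top B)"
    by (simp add: has_sum_def[symmetric])
  moreover have "filterlim A (finite_subsets_at_top B) sequentially"
    unfolding filterlim_finite_subsets_at_top
  proof (intro allI impI)
    fix X assume "finite X \<and> X \<subseteq> B"
    then obtain N where "\<forall>N'\<ge>N. X \<subseteq> A N'" using cover[of X] by auto
    thus "\<forall>\<^sub>F N in sequentially. finite (A N) \<and> X \<subseteq> A N \<and> A N \<subseteq> B"
      using fin un by (auto simp: eventually_sequentially)
  qed
  ultimately show ?thesis by (rule filterlim_compose)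
qed

definition power_weight :: "nat \<Rightarrow> complex \<Rightarrow> complex" where
  "power_weight m z = of_nat m powr (- z)"

lemma norm_power_weight: "norm (power_weight m z) = real m powr (- Re z)"
  by (simp add: power_weight_def norm_powr_real_powr)

lemma power_weight_of_real: "power_weight m (of_real u) = of_real (real m powr (- u))"
proof -
  have "power_weight m (of_real u) = of_real (real m) powr of_real (- u)"
    by (simp add: power_weight_def)
  also have "\<dots> = of_real (real m powr (- u))" by (rule powr_of_real) simp
  finally show ?thesis .
qed

lemma sum_lists_prod_eq_power:
  fixes g :: "nat \<Rightarrow> real"
  assumes "finite A"
  shows "(\<Sum>m | length m = n \<and> set m \<subseteq> A. \<Prod>i<n. g (m ! i)) = (\<Sum>k\<in>A. g k) ^ n"
proof (induction n)
  case 0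
  have "{m. length m = 0 \<and> set m \<subseteq> A} = {[]}" by auto
  thus ?case by simp
next
  case (Suc n)
  let ?L = "{m. length m = n \<and> set m \<subseteq> A}"
  have "(\<Sum>m | length m = Suc n \<and> set m \<subseteq> A. \<Prod>i<Suc n. g (m ! i)) =
      (\<Sum>(k, m)\<in>A \<times> ?L. g k * (\<Prod>i<n. g (m ! i)))"
    by (rule sum.reindex_bij_witness[of _ "\<lambda>(k, m). k # m" "\<lambda>m. (hd m, tl m)"])
      (auto simp: length_Suc_conv prod.lessThan_Suc_shift simp del: prod.lessThan_Suc)
  also have "\<dots> = (\<Sum>k\<in>A. g k) * (\<Sum>m\<in>?L. \<Prod>i<n. g (m ! i))"
    by (simp add: sum.cartesian_product[symmetric] sum_product)
  finally show ?case using Suc by simp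
qed

text \<open>
  With \<open>\<delta> > 0\<close> the amount by which the last exponent exceeds 1 in real part, the last member \<open>m\<^sub>n\<close>
  contributes a spare factor \<open>m\<^sub>n\<close> to the \<open>- \<delta>\<close>.  Splitting it into \<open>n\<close> equal parts and using
  \<open>m\<^sub>i \<le> m\<^sub>n\<close>, every member receives a factor \<open>m\<^sub>i\<close> to the \<open>- \<delta>/n\<close>; so the sum is at most the
  \<open>n\<close>-th power of \<open>\<zeta>(1 + \<delta>/n)\<close>.
\<close>

lemma chain_norm_sums_bounded:
  assumes R: "\<And>k l. R k l \<Longrightarrow> k \<le> l"
    and zs: "zs \<noteq> []" "\<And>z. z \<in> set zs \<Longrightarrow> Re z \<ge> 1" "Re (last zs) > 1"
  obtains K where "\<And>N. (\<Sum>m\<in>chains R N (length zs).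
    norm (\<Prod>i<length zs. power_weight (m ! i) (zs ! i))) \<le> K"
proof -
  define n where "n = length zs"
  define \<delta> where "\<delta> = Re (last zs) - 1"
  define e where "e = 1 + \<delta> / n"
  have n: "n > 0" using zs by (simp add: n_def)
  have \<delta>: "\<delta> > 0" using zs by (simp add: \<delta>_def)
  have e: "e > 1" using n \<delta> by (simp add: e_def)
  let ?g = "\<lambda>k :: nat. real k powr (- e)"
  have summable: "summable ?g" using e by (simp add: summable_real_powr_iff)
  have pointwise: "norm (\<Prod>i<n. power_weight (m ! i) (zs ! i)) \<le> (\<Prod>i<n. ?g (m ! i))"
    if m: "m \<in> chains R N n" for m N
  proof -
    have len: "length m = n" and sorted: "sorted_wrt R m" and "set m \<subseteq> {1..N}"
      using m unfolding chains_def by auto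
    hence pos: "1 \<le> m ! i" if "i < n" for i using nth_mem[of i m] that by fastforce
    have le_last: "m ! i \<le> m ! (n - 1)" if "i < n" for i
    proof (cases "i = n - 1")
      case False
      thus ?thesis using sorted_wrt_nth_less[OF sorted, of i "n - 1"] R that len by auto
    qed simp
    let ?t = "real (m ! (n - 1))"
    have "norm (\<Prod>i<n. power_weight (m ! i) (zs ! i)) = (\<Prod>i<n. real (m ! i) powr (- Re (zs ! i)))"
      by (simp add: prod_norm[symmetric] norm_power_weight)
    also have "\<dots> \<le> (\<Prod>i<n. real (m ! i) powr (- 1) * (if i = n - 1 then ?t powr (- \<delta>) else 1))"
    proof (intro prod_mono conjI)
      fix i assume "i \<in> {..<n}"
      hence i: "i < n" by simp
      show "real (m ! i) powr (- Re (zs ! i)) \<le>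
          real (m ! i) powr (- 1) * (if i = n - 1 then ?t powr (- \<delta>) else 1)"
      proof (cases "i = n - 1")
        case True
        have "zs ! i = last zs" using zs True by (simp add: n_def last_conv_nth)
        hence "- Re (zs ! i) = - 1 + - \<delta>" by (simp add: \<delta>_def)
        thus ?thesis using True by (simp only: powr_add) simp
      next
        case False
        have "Re (zs ! i) \<ge> 1" using i zs(2) by (simp add: n_def)
        hence "real (m ! i) powr (- Re (zs ! i)) \<le> real (m ! i) powr (- 1)"
          using pos[OF i] by (intro powr_mono) auto
        thus ?thesis using False by (simp only: if_False mult_1_right)
      qed
    qed simp
    also have "\<dots> = (\<Prod>i<n. real (m ! i) powr (- 1)) * ?t powr (- \<delta>)"
    proof -
      have "(\<Prod>i<n. if i = n - 1 then ?t powr (- \<delta>) else 1) = ?t powr (- \<delta>)"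
        using n by (subst prod.delta) auto
      thus ?thesis by (simp only: prod.distrib)
    qed
    also have "?t powr (- \<delta>) = (\<Prod>i<n. ?t powr (- (\<delta> / n)))"
    proof -
      have "(\<Prod>i<n. ?t powr (- (\<delta> / n))) = (?t powr (- (\<delta> / n))) ^ n"
        by (simp only: prod_constant card_lessThan)
      also have "\<dots> = ?t powr (real n * - (\<delta> / n))"
        using n pos[of "n - 1"] by (intro powr_power) auto
      also have "real n * - (\<delta> / n) = - \<delta>" using n by simp
      finally show ?thesis by (rule sym)
    qed
    also have "(\<Prod>i<n. real (m ! i) powr (- 1)) * (\<Prod>i<n. ?t powr (- (\<delta> / n))) \<le>
        (\<Prod>i<n. real (m ! i) powr (- 1)) * (\<Prod>i<n. real (m ! i) powr (- (\<delta> / n)))"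
    proof (intro mult_left_mono prod_mono conjI)
      fix i assume "i \<in> {..<n}"
      thus "?t powr (- (\<delta> / n)) \<le> real (m ! i) powr (- (\<delta> / n))"
        using pos[of i] le_last[of i] \<delta> by (intro powr_mono2') auto
    qed (auto intro: prod_nonneg)
    also have "\<dots> = (\<Prod>i<n. ?g (m ! i))"
      by (simp only: prod.distrib[symmetric] powr_add[symmetric] e_def minus_add_distrib)
    finally show ?thesis .
  qed
  have "(\<Sum>m\<in>chains R N n. norm (\<Prod>i<n. power_weight (m ! i) (zs ! i))) \<le> (\<Sum>k. ?g k) ^ n" for N
  proof -
    have "(\<Sum>m\<in>chains R N n. norm (\<Prod>i<n. power_weight (m ! i) (zs ! i)))
        \<le> (\<Sum>m\<in>chains R N n. \<Prod>i<n. ?g (m ! i))"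
      by (intro sum_mono pointwise)
    also have "\<dots> \<le> (\<Sum>m | length m = n \<and> set m \<subseteq> {1..N}. \<Prod>i<n. ?g (m ! i))"
    proof (rule sum_mono2)
      show "finite {m. length m = n \<and> set m \<subseteq> {1..N}}"
        using finite_lists_length_eq[of "{1..N}" n] by (simp add: conj_commute)
    qed (auto simp: chains_def intro: prod_nonneg)
    also have "\<dots> = (\<Sum>k\<in>{1..N}. ?g k) ^ n" by (rule sum_lists_prod_eq_power) simp
    also have "\<dots> \<le> (\<Sum>k. ?g k) ^ n"
      by (intro power_mono sum_le_suminf summable sum_nonneg) auto
    finally show ?thesis .
  qed
  thus thesis using that unfolding n_def by blast
qed

text \<open>
  The common form of \<open>\<zeta>\<close> (for \<open><\<close>) and \<open>\<zeta>\<^sup>\<star>\<close> (for \<open>\<le>\<close>).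
\<close>

definition chain_zeta :: "(nat \<Rightarrow> nat \<Rightarrow> bool) \<Rightarrow> complex list \<Rightarrow> complex" where
  "chain_zeta R z =
     (\<Sum>\<^sub>\<infinity>m\<in>{m :: nat list. length m = length z \<and> (\<forall>x\<in>set m. 0 < x) \<and> sorted_wrt R m}.
        \<Prod>i<length z. of_nat (m ! i) powr (- (z ! i)))"

lemma chain_sum_tendsto:
  assumes R: "\<And>k l. R k l \<Longrightarrow> k \<le> l"
    and zs: "zs \<noteq> []" "\<And>z. z \<in> set zs \<Longrightarrow> Re z \<ge> 1" "Re (last zs) > 1"
  shows "(\<lambda>N. chain_sum R power_weight N zs) \<longlonglongrightarrow> chain_zeta R zs"
proof -
  obtain K where K: "\<And>N. (\<Sum>m\<in>chains R N (length zs).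
      norm (\<Prod>i<length zs. power_weight (m ! i) (zs ! i))) \<le> K"
    using chain_norm_sums_bounded[OF R zs] by blast
  have union: "(\<Union>N. chains R N (length zs)) =
      {m. length m = length zs \<and> (\<forall>x\<in>set m. 0 < x) \<and> sorted_wrt R m}" (is "_ = ?B")
  proof (intro equalityI subsetI)
    fix m assume "m \<in> ?B"
    hence "m \<in> chains R (Max (set m)) (length zs)" by (auto simp: chains_def Suc_le_eq)
    thus "m \<in> (\<Union>N. chains R N (length zs))" by blast
  qed (auto simp: chains_def)
  have "(\<lambda>N. \<Sum>m\<in>chains R N (length zs). \<Prod>i<length zs. power_weight (m ! i) (zs ! i))
      \<longlonglongrightarrow> (\<Sum>\<^sub>\<infinity>m\<in>?B. \<Prod>i<length zs. power_weight (m ! i) (zs ! i))"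
    by (rule infsum_eq_limit_of_exhaustion[OF finite_chains _ union K]) (auto simp: chains_def)
  thus ?thesis by (simp add: chain_sum_def chain_zeta_def power_weight_def)
qed

lemma interval_sum_tendsto:
  assumes R: "\<And>k l. R k l \<Longrightarrow> k \<le> l"
    and a: "\<And>k. Re (a k) \<ge> 1" and p: "Re (a p) > 1"
  shows "(\<lambda>N. interval_sum R (\<lambda>m k. power_weight m (a k)) N p q) \<longlonglongrightarrow>
    (if p < q then 0 else if p = q then 1 else chain_zeta R (map a [q + 1..p]))"
proof (cases p q rule: linorder_cases)
  case greater
  hence snoc: "[q + 1..p] = [q + 1..p - 1] @ [p]" by (intro upto_rec2) auto
  have "chain_sum R (\<lambda>m k. power_weight m (a k)) N ks = chain_sum R power_weight N (map a ks)" for N ks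
    by (simp add: chain_sum_def)
  moreover have "(\<lambda>N. chain_sum R power_weight N (map a [q + 1..p])) \<longlonglongrightarrow> chain_zeta R (map a [q + 1..p])"
    by (rule chain_sum_tendsto) (use R a p snoc in auto)
  ultimately show ?thesis using greater by (simp add: interval_sum_def)
qed (simp_all add: interval_sum_def chain_sum_Nil)

lemma det_from_1_tendsto:
  assumes "\<And>i j. i \<in> {1..n} \<Longrightarrow> j \<in> {1..n} \<Longrightarrow> (\<lambda>N. f N i j) \<longlonglongrightarrow> g i j"
  shows "(\<lambda>N. det_from_1 n (f N)) \<longlonglongrightarrow> det_from_1 n g"
  unfolding det_from_1_leibniz
proof (intro tendsto_sum tendsto_mult tendsto_const tendsto_prod assms)
  fix p i assume "p \<in> {p. p permutes {0..<n}}" "i \<in> {1..n}"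
  thus "p (i - 1) + 1 \<in> {1..n}"
    using permutes_in_image[of p "{0..<n}" "i - 1"] by (auto simp: Suc_le_eq)
qed

text \<open>
  The identity is assumed for all exponents \<open>b\<close> in order to apply it twice.  For \<open>b = Re a\<close> the
  weights are the absolute values of those for \<open>a\<close>, so that convergence of the determinants bounds
  the sums of absolute values; for \<open>b = a\<close> it then identifies the limit.
\<close>

lemma schur_zeta_eq_det:
  fixes \<nu> \<mu> :: "nat \<Rightarrow> nat" and t :: "nat \<times> nat \<Rightarrow> complex" and a :: "int \<Rightarrow> complex"
    and \<Phi> :: "(int \<Rightarrow> complex) \<Rightarrow> nat \<Rightarrow> nat \<Rightarrow> nat \<Rightarrow> complex"
  assumes fin: "finite (diagram \<nu>)" and sub: "diagram \<mu> \<subseteq> diagram \<nu>"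
    and t: "\<forall>(i, j)\<in>skew_diagram \<nu> \<mu>. t (i, j) = a (int j - int i)"
    and identity: "\<And>b N. tableau_sum (\<lambda>m k. power_weight m (b k)) N (diagram \<nu>) (diagram \<mu>)
      = det_from_1 n (\<Phi> b N)"
    and lim: "\<And>b i j. (\<And>k. Re (b k) = Re (a k)) \<Longrightarrow> i \<in> {1..n} \<Longrightarrow> j \<in> {1..n} \<Longrightarrow>
      (\<lambda>N. \<Phi> b N i j) \<longlonglongrightarrow> \<Psi> b i j"
  shows "schur_zeta \<nu> \<mu> t = det_from_1 n (\<Psi> a)"
proof -
  let ?D = "skew_diagram \<nu> \<mu>"
  let ?T = "\<lambda>N. tableaux N ?D"
  let ?f = "\<lambda>b m. \<Prod>p\<in>?D. power_weight (m p) (b (content p))"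
  define b where "b k = complex_of_real (Re (a k))" for k
  have finD: "finite ?D" using fin by (simp add: skew_diagram_def)
  have sums: "(\<Sum>m\<in>?T N. ?f c m) = det_from_1 n (\<Phi> c N)" for c N
    using identity[of c N] sub by (simp add: tableau_sum_def skew_diagram_def)
  have limit: "(\<lambda>N. \<Sum>m\<in>?T N. ?f c m) \<longlonglongrightarrow> det_from_1 n (\<Psi> c)"
    if "\<And>k. Re (c k) = Re (a k)" for c
    unfolding sums by (intro det_from_1_tendsto lim that)
  have norm_sum: "(\<Sum>m\<in>?T N. ?f b m) = of_real (\<Sum>m\<in>?T N. norm (?f a m))" for N
    by (simp add: prod_norm[symmetric] norm_power_weight b_def power_weight_of_real)
  have "Bseq (\<lambda>N. \<Sum>m\<in>?T N. ?f b m)"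
    using limit[of b] by (intro convergent_imp_Bseq convergentI) (auto simp: b_def)
  then obtain K where "\<And>N. norm (\<Sum>m\<in>?T N. ?f b m) \<le> K" by (auto simp: Bseq_def)
  hence bound: "(\<Sum>m\<in>?T N. norm (?f a m)) \<le> K" for N
    unfolding norm_sum norm_of_real by (meson abs_le_iff)
  have union: "(\<Union>N. ?T N) = SSYT \<nu> \<mu>"
  proof (intro equalityI subsetI)
    fix m assume m: "m \<in> SSYT \<nu> \<mu>"
    have "m p \<in> {1..Max (insert 0 (m ` ?D))}" if "p \<in> ?D" for p
      using m that finD by (auto simp: SSYT_def fillings_def Suc_le_eq)
    moreover have "m \<in> extensional ?D" using m by (simp add: SSYT_def fillings_def PiE_iff)
    ultimately have "m \<in> ?T (Max (insert 0 (m ` ?D)))"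
      using m unfolding SSYT_def tableaux_def by (simp add: PiE_iff)
    thus "m \<in> (\<Union>N. ?T N)" by blast
  next
    fix m assume "m \<in> (\<Union>N. ?T N)"
    then obtain N where m: "m \<in> ?T N" by blast
    hence "m \<in> fillings \<nu> \<mu> {0<..}" by (auto simp: tableaux_def fillings_def PiE_iff Suc_le_eq)
    thus "m \<in> SSYT \<nu> \<mu>" using m unfolding SSYT_def tableaux_def by blast
  qed
  have mono: "?T N \<subseteq> ?T (Suc N)" for N
  proof
    fix m assume m: "m \<in> ?T N"
    hence "m \<in> ?D \<rightarrow>\<^sub>E {1..Suc N}" by (auto simp: tableaux_def PiE_iff intro: le_SucI)
    thus "m \<in> ?T (Suc N)" using m unfolding tableaux_def by blast
  qed
  have "(\<lambda>N. \<Sum>m\<in>?T N. ?f a m) \<longlonglongrightarrow> infsum (?f a) (SSYT \<nu> \<mu>)"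
    by (rule infsum_eq_limit_of_exhaustion[OF finite_tableaux[OF finD] mono union bound])
  hence "infsum (?f a) (SSYT \<nu> \<mu>) = det_from_1 n (\<Psi> a)"
    using limit[of a] LIMSEQ_unique by blast
  moreover have "?f a m = (\<Prod>p\<in>?D. of_nat (m p) powr (- t p))" for m
    using t by (intro prod.cong) (auto simp: power_weight_def content_def)
  ultimately show ?thesis by (simp add: schur_zeta_def)
qed

section \<open>Jacobi--Trudi formulas for Schur multiple zeta functions\<close>

lemma chain_zeta_strict: "chain_zeta (<) = multi_zeta"
  by (simp add: fun_eq_iff chain_zeta_def multi_zeta_def)

lemma chain_zeta_weak: "chain_zeta (\<le>) = multi_zeta_star"
  by (simp add: fun_eq_iff chain_zeta_def multi_zeta_star_def)

lemma antitone_partition: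
  assumes "is_partition \<nu>"
  shows "antitone_upto n \<nu>"
  using assms by (simp add: is_partition_def antitone_upto_def)

lemma diagram_eq_rows_diagram:
  assumes "part_subset \<nu> (rect_part s r)"
  shows "diagram \<nu> = rows_diagram r \<nu>"
proof -
  have zero: "\<nu> i = 0" if "1 \<le> i" "\<not> i \<le> r" for i
    using assms that by (auto simp: part_subset_def rect_part_def dest!: spec[of _ i])
  have "(i, j) \<in> diagram \<nu> \<longleftrightarrow> (i, j) \<in> rows_diagram r \<nu>" for i j
    using zero[of i] unfolding mem_rows_diagram diagram_def by (cases "i \<le> r") auto
  thus ?thesis by auto
qed

text \<open>
  The set counted by \<open>conj_part \<nu> j\<close> is an initial segment of the positive integers, because \<open>\<nu>\<close>
  is weakly decreasing.
\<close>

lemma conj_part_le_iff: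
  assumes \<nu>: "is_partition \<nu>" and ij: "1 \<le> i" "1 \<le> j"
  shows "i \<le> conj_part \<nu> j \<longleftrightarrow> j \<le> \<nu> i"
proof -
  let ?S = "{i. 1 \<le> i \<and> j \<le> \<nu> i}"
  have fin: "finite ?S"
    by (rule finite_subset[of _ "{i. 1 \<le> i \<and> \<nu> i \<noteq> 0}"]) (use \<nu> ij in \<open>auto simp: is_partition_def\<close>)
  have down: "k \<in> ?S" if "l \<in> ?S" "1 \<le> k" "k \<le> l" for k l
    using antitone_uptoD[OF antitone_partition[OF \<nu>, of l], of k l] that by auto
  show ?thesis
  proof
    assume "j \<le> \<nu> i"
    hence "{1..i} \<subseteq> ?S" using down[of i] ij by auto
    hence "card {1..i} \<le> card ?S" by (rule card_mono[OF fin])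
    thus "i \<le> conj_part \<nu> j" by (simp add: conj_part_def)
  next
    assume le: "i \<le> conj_part \<nu> j"
    show "j \<le> \<nu> i"
    proof (rule ccontr)
      assume "\<not> j \<le> \<nu> i"
      hence "k < i" if "k \<in> ?S" for k
        using down[OF that, of i] ij by (cases "i \<le> k") auto
      hence "?S \<subseteq> {1..<i}" by auto
      hence "card ?S \<le> card {1..<i}" by (intro card_mono) auto
      thus False using le ij by (simp add: conj_part_def)
    qed
  qed
qed

lemma diagram_eq_cols_diagram:
  assumes \<nu>: "is_partition \<nu>" and sub: "part_subset \<nu> (rect_part s r)"
  shows "diagram \<nu> = cols_diagram s (conj_part \<nu>)"
proof -
  have "j \<le> s" if "1 \<le> i" "j \<le> \<nu> i" for i j
    using sub that by (auto simp: part_subset_def rect_part_def dest!: spec[of _ i] split: if_splits)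
  hence "(i, j) \<in> diagram \<nu> \<longleftrightarrow> (i, j) \<in> cols_diagram s (conj_part \<nu>)" for i j
    using conj_part_le_iff[OF \<nu>, of i j]
    unfolding mem_cols_diagram mem_rows_diagram diagram_def by auto
  thus ?thesis by auto
qed

lemma antitone_conj_part:
  assumes \<nu>: "is_partition \<nu>"
  shows "antitone_upto n (conj_part \<nu>)"
  unfolding antitone_upto_def
proof
  fix j assume j: "j \<in> {1..<n}"
  show "conj_part \<nu> (Suc j) \<le> conj_part \<nu> j"
  proof (cases "conj_part \<nu> (Suc j) = 0")
    case False
    hence "Suc j \<le> \<nu> (conj_part \<nu> (Suc j))"
      using conj_part_le_iff[OF \<nu>, of "conj_part \<nu> (Suc j)" "Suc j"] by simp
    thus ?thesis using conj_part_le_iff[OF \<nu>, of "conj_part \<nu> (Suc j)" j] False j by simp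
  qed simp
qed

lemma map_shift_upto: "map (\<lambda>k. f (q + k)) [1..n] = map f [q + 1..q + n]"
proof -
  have "map (\<lambda>k. q + k) [1..n] = [q + 1..q + n]"
    by (rule nth_equalityI) (auto simp: nth_upto)
  hence "map f (map (\<lambda>k. q + k) [1..n]) = map f [q + 1..q + n]" by simp
  thus ?thesis by (simp add: o_def)
qed

theorem theorem4p3:
  fixes r s :: nat
    and \<nu> \<mu> :: "nat \<Rightarrow> nat"
    and t :: "nat \<times> nat \<Rightarrow> complex"
    and a :: "int \<Rightarrow> complex"
  assumes "0 < r" and "0 < s"
    and "is_partition \<nu>" and "is_partition \<mu>"
    and "part_subset \<mu> \<nu>" and "part_subset \<nu> (rect_part s r)"
    and "t \<in> W_diag \<nu> \<mu>"
    and "\<forall>k. Re (a k) \<ge> 1"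
    and "\<forall>(i, j) \<in> skew_diagram \<nu> \<mu>. t (i, j) = a (int j - int i)"
  shows
    "((\<forall>i\<in>{1..r}. Re (a (int (\<nu> i) - int i)) > 1) \<longrightarrow>
        schur_zeta \<nu> \<mu> t =
          det_from_1 r (\<lambda>i j.
            let n = int (\<nu> i) - int (\<mu> j) - int i + int j in
            if n < 0 then 0 else if n = 0 then 1
            else multi_zeta_star (map (\<lambda>k. a (int (\<mu> j) - int j + k)) [1..n])))
     \<and>
     ((\<forall>i\<in>{1..s}. Re (a (int i - int (conj_part \<nu> i))) > 1) \<longrightarrow>
        schur_zeta \<nu> \<mu> t =
          det_from_1 s (\<lambda>i j.
            let n = int (conj_part \<nu> i) - int (conj_part \<mu> j) - int i + int j in
            if n < 0 then 0 else if n = 0 then 1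
            else multi_zeta (map (\<lambda>k. a (- int (conj_part \<mu> j) + int j - k)) [1..n])))"
proof (intro conjI impI)
  have \<nu>: "is_partition \<nu>" and \<mu>: "is_partition \<mu>" and sub: "part_subset \<mu> \<nu>"
    and rect: "part_subset \<nu> (rect_part s r)" and a: "\<And>k. Re (a k) \<ge> 1"
    and t: "\<forall>(i, j)\<in>skew_diagram \<nu> \<mu>. t (i, j) = a (int j - int i)"
    using assms by auto
  have rect_\<mu>: "part_subset \<mu> (rect_part s r)"
    using sub rect unfolding part_subset_def by (meson order_trans)
  have fin: "finite (diagram \<nu>)"
    using young_rows_diagram[OF antitone_partition[OF \<nu>, of r]]
    by (simp add: diagram_eq_rows_diagram[OF rect] young_def)
  have subset: "diagram \<mu> \<subseteq> diagram \<nu>"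
    using sub unfolding part_subset_def diagram_def by (auto intro: order_trans)
  {
    assume last: "\<forall>i\<in>{1..r}. Re (a (int (\<nu> i) - int i)) > 1"
    define P where "P b N i j = interval_sum (\<le>) (\<lambda>m k. power_weight m (b k)) N
      (int (\<nu> i) - int i) (int (\<mu> j) - int j)" for b N i j
    define Q where "Q b i j = (let p = int (\<nu> i) - int i; q = int (\<mu> j) - int j in
      if p < q then 0 else if p = q then 1 else chain_zeta (\<le>) (map b [q + 1..p]))" for b i j
    have "schur_zeta \<nu> \<mu> t = det_from_1 r (Q a)"
    proof (rule schur_zeta_eq_det[where \<Phi> = P and n = r and \<Psi> = Q, OF fin subset t])
      fix b N
      show "tableau_sum (\<lambda>m k. power_weight m (b k)) N (diagram \<nu>) (diagram \<mu>) = det_from_1 r (P b N)"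
        unfolding P_def diagram_eq_rows_diagram[OF rect] diagram_eq_rows_diagram[OF rect_\<mu>]
        by (rule finite_jacobi_trudi) (intro antitone_partition \<nu> \<mu>)+
    next
      fix b i j
      assume b: "\<And>k. Re (b k) = Re (a k)" and "i \<in> {1..r}"
      hence "Re (b (int (\<nu> i) - int i)) > 1" using last by simp
      thus "(\<lambda>N. P b N i j) \<longlonglongrightarrow> Q b i j"
        unfolding P_def Q_def Let_def by (intro interval_sum_tendsto) (use a b in auto)
    qed
    also have "\<dots> = det_from_1 r (\<lambda>i j.
            let n = int (\<nu> i) - int (\<mu> j) - int i + int j in
            if n < 0 then 0 else if n = 0 then 1
            else multi_zeta_star (map (\<lambda>k. a (int (\<mu> j) - int j + k)) [1..n]))"
    proof (rule det_from_1_cong)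
      fix i j :: nat
      define p q where "p = int (\<nu> i) - int i" and "q = int (\<mu> j) - int j"
      have n: "int (\<nu> i) - int (\<mu> j) - int i + int j = p - q" by (simp add: p_def q_def)
      show "Q a i j = (let n = int (\<nu> i) - int (\<mu> j) - int i + int j in
            if n < 0 then 0 else if n = 0 then 1
            else multi_zeta_star (map (\<lambda>k. a (int (\<mu> j) - int j + k)) [1..n]))"
        unfolding n Q_def Let_def p_def[symmetric] q_def[symmetric] map_shift_upto chain_zeta_weak
        by simp
    qed
    finally show "schur_zeta \<nu> \<mu> t = \<dots>" .
  }
  {
    assume last: "\<forall>i\<in>{1..s}. Re (a (int i - int (conj_part \<nu> i))) > 1"
    define P where "P b N i j = interval_sum (<) (\<lambda>m k. power_weight m (b (- k))) N
      (int (conj_part \<nu> i) - int i) (int (conj_part \<mu> j) - int j)" for b N i j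
    define Q where "Q b i j = (let p = int (conj_part \<nu> i) - int i; q = int (conj_part \<mu> j) - int j in
      if p < q then 0 else if p = q then 1 else chain_zeta (<) (map (\<lambda>k. b (- k)) [q + 1..p]))" for b i j
    have "schur_zeta \<nu> \<mu> t = det_from_1 s (Q a)"
    proof (rule schur_zeta_eq_det[where \<Phi> = P and n = s and \<Psi> = Q, OF fin subset t])
      fix b N
      show "tableau_sum (\<lambda>m k. power_weight m (b k)) N (diagram \<nu>) (diagram \<mu>) = det_from_1 s (P b N)"
        unfolding P_def diagram_eq_cols_diagram[OF \<nu> rect] diagram_eq_cols_diagram[OF \<mu> rect_\<mu>]
        by (rule finite_dual_jacobi_trudi) (intro antitone_conj_part \<nu> \<mu>)+
    next
      fix b i j
      assume b: "\<And>k. Re (b k) = Re (a k)" and "i \<in> {1..s}"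
      hence "Re (b (- (int (conj_part \<nu> i) - int i))) > 1" using last by simp
      thus "(\<lambda>N. P b N i j) \<longlonglongrightarrow> Q b i j"
        unfolding P_def Q_def Let_def
        by (intro interval_sum_tendsto[where a = "\<lambda>k. b (- k)"]) (use a b in auto)
    qed
    also have "\<dots> = det_from_1 s (\<lambda>i j.
            let n = int (conj_part \<nu> i) - int (conj_part \<mu> j) - int i + int j in
            if n < 0 then 0 else if n = 0 then 1
            else multi_zeta (map (\<lambda>k. a (- int (conj_part \<mu> j) + int j - k)) [1..n]))"
    proof (rule det_from_1_cong)
      fix i j :: nat
      define p q where "p = int (conj_part \<nu> i) - int i" and "q = int (conj_part \<mu> j) - int j"
      have n: "int (conj_part \<nu> i) - int (conj_part \<mu> j) - int i + int j = p - q"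
        and neg: "\<And>k. - int (conj_part \<mu> j) + int j - k = - (q + k)" by (simp_all add: p_def q_def)
      show "Q a i j = (let n = int (conj_part \<nu> i) - int (conj_part \<mu> j) - int i + int j in
            if n < 0 then 0 else if n = 0 then 1
            else multi_zeta (map (\<lambda>k. a (- int (conj_part \<mu> j) + int j - k)) [1..n]))"
        unfolding n neg Q_def Let_def p_def[symmetric] q_def[symmetric]
          map_shift_upto[of "\<lambda>k. a (- k)"] chain_zeta_strict
        by simp
    qed
    finally show "schur_zeta \<nu> \<mu> t = \<dots>" .
  }
qed

end
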